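(* Consider Bernoulli site percolation on the Cayley graph $X(G,S)$ with parameter $\mathsf{p}=1/|H|$. Let $\mathfrak{m}$ be the Plancherel measure of the lamplighter random walk on $H\wr G$ with law $\widetilde\mu=\nu*\mu*\nu$, and let $\mathfrak{n}_\omega$ be the spectral measure (at $e$) of the random walk with absorbing boundary on the percolation cluster $C_\omega(e)$ of $e$. Then $$\mathfrak{m}(B)=\mathsf{E}_{\mathsf{p}}\bigl(\mathfrak{n}_\omega(B)\bigr)\quad\text{for every Borel set } B\subset\mathbb{R}.$$ Equivalently, the return probabilities of the respective random walks satisfy $$\widetilde\mu^{(n)}(\iota,e)=\mathsf{E}_{\mathsf{p}}\bigl(p_\omega^{(n)}(e,e)\bigr)\quad\text{for all } n\ge 0.$$
   Context: $G$ is a finitely generated group with identity $e$; $H$ is a finite group with identity $o$ and $|H|\ge 2$. Let $\mathcal{L}=\bigoplus_G H$ be the group (under pointwise multiplication) of functions $\eta:G\to H$ with finite support $\{x:\eta(x)\ne o\}$; its identity is $\iota\equiv o$. $G$ acts on $\mathcal L$ by $L_g\eta(x)=\eta(g^{-1}x)$. The lamplighter group is $H\wr G=\mathcal{L}\rtimes G$ with $(\eta,g)(\eta',g')=(\eta\cdot L_g\eta',gg')$. $G$ and $H$ embed into $H\wr G$ via $g\mapsto(\iota,g)$ and $h\mapsto(\eta_e^h,e)$, where $\eta_e^h(e)=h$ and $\eta_e^h(x)=o$ for $x\neq e$; measures on $G$ and $H$ are regarded as measures on $H\wr G$ via these embeddings. $\mu$ is a symmetric probability measure on $G$ whose support $S$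 is finite and generates $G$; $p(x,y)=\mu(x^{-1}y)$. The Cayley graph $X(G,S)$ has vertex set $G$ and unoriented edges $[x,xs]$, $x\in G$, $s\in S$. $\nu$ is the uniform distribution on $H$, and $\widetilde\mu=\nu*\mu*\nu$ on $H\wr G$. $\widetilde\mu^{(n)}$ is its $n$-th convolution power. The Plancherel measure $\mathfrak m$ is the diagonal element at $(\iota,e)$ of the resolution of the identity of the self-adjoint right convolution operator $F\mapsto F*\widetilde\mu$ on $\ell^2(H\wr G)$, i.e. the probability measure on $[-1,1]$ with $\int t^n\,d\mathfrak m(t)=\widetilde\mu^{(n)}(\iota,e)$ for all $n\ge0$. Site percolation with parameter $\mathsf{p}$: on a probability space $(\Omega,\mathcal A,\mathsf{Pr}_{\mathsf p})$ with expectation $\mathsf{E}_{\mathsf p}$, each vertex of $X(G,S)$ is independently open with probability $\mathsf{p}$ and closed with probability $1-\mathsf{p}$. If $e$ is open, $C_\omega(e)$ is the set of open vertices connected to $e$ by a path of open vertices; if $e$ is closed, $C_\omega(e)=\emptyset$. For $A\subset G$ which is empty or contains $e$ and induces a (finite or infinite) connected subgraph, set $p_A(x,y)=p(x,y)$ if $x,y\in A$ and $0$ otherwise; $P_Af(x)=\sum_y p_A(x,y)f(y)$ is a self-adjoint operator on $\ell^2(G)$, with $P_\emptyset=0$. $p_A^{(n)}(x,y)$ denotes the matrix entries of $P_A^n$, with $p_A^{(0)}(e,e)=1$ also for $A=\emptyset$. $\mathfrak n_A$ is the diagonal element at $e$ of the spectral resolution of $P_A$, i.e. the probability measure on $[-1,1]$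 with $\int t^n\,d\mathfrak n_A(t)=p_A^{(n)}(e,e)$ for $n\ge0$. Finally $\mathfrak n_\omega=\mathfrak n_{C_\omega(e)}$ and $p_\omega^{(n)}=p_{C_\omega(e)}^{(n)}$. *)

theory Defs
  imports "HOL-Probability.Probability" "HOL-Algebra.Product_Groups"
begin

text \<open>
  Wreath product: lamp configurations are elements of the restricted direct sum of copies of
  \<open>H\<close> indexed by \<open>carrier G\<close>; they are extensional (equal to \<open>undefined\<close> outside
  \<open>carrier G\<close>).
\<close>

definition lamps :: "('g, 'a) monoid_scheme \<Rightarrow> ('h, 'b) monoid_scheme \<Rightarrow> ('g \<Rightarrow> 'h) monoid"
  where "lamps G H = sum_group (carrier G) (\<lambda>_. H)"

definition translate :: "('g, 'a) monoid_scheme \<Rightarrow> 'g \<Rightarrow> ('g \<Rightarrow> 'h) \<Rightarrow> 'g \<Rightarrow> 'h"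
  where "translate G g \<eta> = (\<lambda>x\<in>carrier G. \<eta> (inv\<^bsub>G\<^esub> g \<otimes>\<^bsub>G\<^esub> x))"

definition wreath :: "('h, 'b) monoid_scheme \<Rightarrow> ('g, 'a) monoid_scheme \<Rightarrow> (('g \<Rightarrow> 'h) \<times> 'g) monoid"
  where "wreath H G =
    \<lparr>carrier = carrier (lamps G H) \<times> carrier G,
     monoid.mult = (\<lambda>(\<eta>, g) (\<eta>', g'). (\<eta> \<otimes>\<^bsub>lamps G H\<^esub> translate G g \<eta>', g \<otimes>\<^bsub>G\<^esub> g')),
     one = (\<one>\<^bsub>lamps G H\<^esub>, \<one>\<^bsub>G\<^esub>)\<rparr>"

definition embed_base :: "('h, 'b) monoid_scheme \<Rightarrow> ('g, 'a) monoid_scheme \<Rightarrow> 'g \<Rightarrow> ('g \<Rightarrow> 'h) \<times> 'g"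
  where "embed_base H G g = (\<one>\<^bsub>lamps G H\<^esub>, g)"

definition embed_lamp :: "('h, 'b) monoid_scheme \<Rightarrow> ('g, 'a) monoid_scheme \<Rightarrow> 'h \<Rightarrow> ('g \<Rightarrow> 'h) \<times> 'g"
  where "embed_lamp H G h = ((\<lambda>x\<in>carrier G. if x = \<one>\<^bsub>G\<^esub> then h else \<one>\<^bsub>H\<^esub>), \<one>\<^bsub>G\<^esub>)"

definition convolve :: "('k, 'a) monoid_scheme \<Rightarrow> 'k pmf \<Rightarrow> 'k pmf \<Rightarrow> 'k pmf"
  where "convolve K p q = map_pmf (\<lambda>(x, y). x \<otimes>\<^bsub>K\<^esub> y) (pair_pmf p q)"

primrec conv_power :: "('k, 'a) monoid_scheme \<Rightarrow> 'k pmf \<Rightarrow> nat \<Rightarrow> 'k pmf"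
  where
    "conv_power K p 0 = return_pmf \<one>\<^bsub>K\<^esub>"
  | "conv_power K p (Suc n) = convolve K (conv_power K p n) p"

definition lamplighter_law ::
    "('h, 'b) monoid_scheme \<Rightarrow> ('g, 'a) monoid_scheme \<Rightarrow> 'g pmf \<Rightarrow> (('g \<Rightarrow> 'h) \<times> 'g) pmf"
  where "lamplighter_law H G \<mu> =
    (let \<nu> = map_pmf (embed_lamp H G) (pmf_of_set (carrier H))
     in convolve (wreath H G) (convolve (wreath H G) \<nu> (map_pmf (embed_base H G) \<mu>)) \<nu>)"

text \<open>
  The Hilbert space \<open>\<ell>\<^sup>2(X)\<close>, realised as the complex functions vanishing outside \<open>X\<close>.
\<close>

definition ell2 :: "'x set \<Rightarrow> ('x \<Rightarrow> complex) set"
  where "ell2 X = {f. (\<forall>x. x \<notin> X \<longrightarrow> f x = 0) \<and> (\<lambda>x. (cmod (f x))\<^sup>2) summable_on X}"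

definition ell2_inner :: "'x set \<Rightarrow> ('x \<Rightarrow> complex) \<Rightarrow> ('x \<Rightarrow> complex) \<Rightarrow> complex"
  where "ell2_inner X f g = (\<Sum>\<^sub>\<infinity>x\<in>X. f x * cnj (g x))"

definition delta :: "'x \<Rightarrow> 'x \<Rightarrow> complex"
  where "delta x = (\<lambda>y. if y = x then 1 else 0)"

definition orthogonal_projection :: "'x set \<Rightarrow> (('x \<Rightarrow> complex) \<Rightarrow> 'x \<Rightarrow> complex) \<Rightarrow> bool"
  where "orthogonal_projection X P \<longleftrightarrow>
    (\<forall>f\<in>ell2 X. P f \<in> ell2 X \<and> P (P f) = P f) \<and>
    (\<forall>f\<in>ell2 X. \<forall>g\<in>ell2 X. \<forall>a b.
       P (\<lambda>x. a * f x + b * g x) = (\<lambda>x. a * P f x + b * P g x)) \<and>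
    (\<forall>f\<in>ell2 X. \<forall>g\<in>ell2 X. ell2_inner X (P f) g = ell2_inner X f (P g))"

definition diagonal_measure ::
    "'x set \<Rightarrow> (real set \<Rightarrow> ('x \<Rightarrow> complex) \<Rightarrow> 'x \<Rightarrow> complex) \<Rightarrow> ('x \<Rightarrow> complex) \<Rightarrow> real measure"
  where "diagonal_measure X E f =
    measure_of UNIV (sets borel) (\<lambda>B. ennreal (Re (ell2_inner X (E B f) f)))"

text \<open>
  \<open>E\<close> is the (projection-valued) resolution of the identity of the bounded self-adjoint
  operator \<open>T\<close> on \<open>\<ell>\<^sup>2(X)\<close>, that is, \<open>T = \<integral> t dE(t)\<close> with \<open>E\<close> compactly supported.
  The integral is meant weakly; by polarization it is enough to have it on the diagonal.
  Values of \<open>E\<close> at non-Borel sets and of the operators outside \<open>\<ell>\<^sup>2(X)\<close> are irrelevant.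
\<close>

definition resolution_of_identity ::
    "'x set \<Rightarrow> (('x \<Rightarrow> complex) \<Rightarrow> 'x \<Rightarrow> complex)
      \<Rightarrow> (real set \<Rightarrow> ('x \<Rightarrow> complex) \<Rightarrow> 'x \<Rightarrow> complex) \<Rightarrow> bool"
  where "resolution_of_identity X T E \<longleftrightarrow>
    (\<forall>B\<in>sets borel. orthogonal_projection X (E B)) \<and>
    (\<exists>r. \<forall>f\<in>ell2 X. E {-r..r} f = f) \<and>
    (\<forall>A\<in>sets borel. \<forall>B\<in>sets borel. \<forall>f\<in>ell2 X. E (A \<inter> B) f = E A (E B f)) \<and>
    (\<forall>A :: nat \<Rightarrow> real set. range A \<subseteq> sets borel \<longrightarrow> disjoint_family A \<longrightarrow>
       (\<forall>f\<in>ell2 X. \<forall>g\<in>ell2 X.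
          (\<lambda>i. ell2_inner X (E (A i) f) g) sums ell2_inner X (E (\<Union>i. A i) f) g)) \<and>
    (\<forall>f\<in>ell2 X. integrable (diagonal_measure X E f) (\<lambda>t. t) \<and>
       ell2_inner X (T f) f = complex_of_real (\<integral>t. t \<partial>diagonal_measure X E f))"

definition spectral_measure_at ::
    "'x set \<Rightarrow> (('x \<Rightarrow> complex) \<Rightarrow> 'x \<Rightarrow> complex) \<Rightarrow> 'x \<Rightarrow> real measure \<Rightarrow> bool"
  where "spectral_measure_at X T x M \<longleftrightarrow>
    (\<exists>E. resolution_of_identity X T E \<and> M = diagonal_measure X E (delta x))"

definition kernel_operator ::
    "'x set \<Rightarrow> ('x \<Rightarrow> 'x \<Rightarrow> real) \<Rightarrow> ('x \<Rightarrow> complex) \<Rightarrow> 'x \<Rightarrow> complex"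
  where "kernel_operator X k f =
    (\<lambda>x. if x \<in> X then (\<Sum>\<^sub>\<infinity>y\<in>X. complex_of_real (k x y) * f y) else 0)"

text \<open>\<open>(F * p)(x) = \<Sum>\<^sub>y F(y) p(y\<inverse>x)\<close>\<close>

definition right_convolution ::
    "('k, 'a) monoid_scheme \<Rightarrow> 'k pmf \<Rightarrow> ('k \<Rightarrow> complex) \<Rightarrow> 'k \<Rightarrow> complex"
  where "right_convolution K p =
    kernel_operator (carrier K) (\<lambda>x y. pmf p (inv\<^bsub>K\<^esub> y \<otimes>\<^bsub>K\<^esub> x))"

definition is_plancherel_measure :: "('k, 'a) monoid_scheme \<Rightarrow> 'k pmf \<Rightarrow> real measure \<Rightarrow> bool"
  where "is_plancherel_measure K p M \<longleftrightarrow>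
    spectral_measure_at (carrier K) (right_convolution K p) \<one>\<^bsub>K\<^esub> M"

definition restricted_kernel ::
    "('g, 'a) monoid_scheme \<Rightarrow> 'g pmf \<Rightarrow> 'g set \<Rightarrow> 'g \<Rightarrow> 'g \<Rightarrow> real"
  where "restricted_kernel G \<mu> A x y =
    (if x \<in> A \<and> y \<in> A then pmf \<mu> (inv\<^bsub>G\<^esub> x \<otimes>\<^bsub>G\<^esub> y) else 0)"

definition restricted_operator ::
    "('g, 'a) monoid_scheme \<Rightarrow> 'g pmf \<Rightarrow> 'g set \<Rightarrow> ('g \<Rightarrow> complex) \<Rightarrow> 'g \<Rightarrow> complex"
  where "restricted_operator G \<mu> A = kernel_operator (carrier G) (restricted_kernel G \<mu> A)"

primrec restricted_kernel_power ::
    "('g, 'a) monoid_scheme \<Rightarrow> 'g pmf \<Rightarrow> 'g set \<Rightarrow> nat \<Rightarrow> 'g \<Rightarrow> 'g \<Rightarrow> real"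
  where
    "restricted_kernel_power G \<mu> A 0 x y = (if x = y then 1 else 0)"
  | "restricted_kernel_power G \<mu> A (Suc n) x y =
      (\<Sum>\<^sub>\<infinity>z\<in>carrier G. restricted_kernel_power G \<mu> A n x z * restricted_kernel G \<mu> A z y)"

definition cayley_adj :: "('g, 'a) monoid_scheme \<Rightarrow> 'g set \<Rightarrow> 'g \<Rightarrow> 'g \<Rightarrow> bool"
  where "cayley_adj G S x y \<longleftrightarrow>
    x \<in> carrier G \<and> y \<in> carrier G \<and> (\<exists>s\<in>S. y = x \<otimes>\<^bsub>G\<^esub> s \<or> x = y \<otimes>\<^bsub>G\<^esub> s)"

definition open_cluster :: "('g, 'a) monoid_scheme \<Rightarrow> 'g set \<Rightarrow> ('g \<Rightarrow> bool) \<Rightarrow> 'g set"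
  where "open_cluster G S opn =
    {y. opn \<one>\<^bsub>G\<^esub> \<and> (\<lambda>u v. cayley_adj G S u v \<and> opn u \<and> opn v)\<^sup>*\<^sup>* \<one>\<^bsub>G\<^esub> y}"

text \<open>\<open>opn x \<omega>\<close>: vertex \<open>x\<close> is open in the configuration \<open>\<omega>\<close>.\<close>

definition site_percolation :: "'w measure \<Rightarrow> 'x set \<Rightarrow> ('x \<Rightarrow> 'w \<Rightarrow> bool) \<Rightarrow> real \<Rightarrow> bool"
  where "site_percolation \<Omega> V opn p \<longleftrightarrow>
    prob_space \<Omega> \<and>
    prob_space.indep_events \<Omega> (\<lambda>x. {\<omega> \<in> space \<Omega>. opn x \<omega>}) V \<and>
    (\<forall>x\<in>V. measure \<Omega> {\<omega> \<in> space \<Omega>. opn x \<omega>} = p)"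

end

theory Submission
  imports Defs
begin

text \<open>
  The lamp at a vertex is randomized exactly when the base walk visits it, so after \<open>n\<close> steps
  the configuration is uniform on the configurations supported in the set \<open>R\<close> of visited vertices,
  and it is trivial with probability \<open>(1/|H|) ^ |R|\<close>. This is also the probability that all of
  \<open>R\<close> is open; since \<open>R\<close> is connected and contains the identity, that event says that the walk
  has not left the cluster. Hence the return probabilities agree. They are the moments of the two
  spectral measures, which live on \<open>[-1, 1]\<close> and are therefore determined by them.
\<close>

subsection \<open>Linear operators on \<open>\<ell>\<^sup>2\<close>\<close>


text \<open>Both sides of the return identity are finite sums over one joint law of
  (\<open>R\<close>, endpoint) for the free walk. \<open>\<nu>\<close> stands on both sides of
  \<open>\<mu>\<close>, so a step randomizes the lamps at both of its endpoints, and these are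
  exactly the vertices that p_A requires to lie in \<open>A\<close>. No step at all means
  \<open>R = {}\<close>, which matches the convention p^(0)(e,e) = 1 on the empty cluster. Three
  obstacles shape the analytic half. \<open>resolution_of_identity\<close> ties \<open>T\<close> to
  \<open>E\<close> only through first moments of the diagonal measures, so higher moments need a
  functional calculus; step functions of mesh 1/N suffice, once a bound on the quadratic form of
  \<open>T\<close> minus its step operator is turned into a norm bound. The support of
  \<open>E\<close> is only known to be bounded by some \<open>r\<close>; that the measures sit on
  [-1, 1] is read off from their moments, which never exceed 1 in absolute value. Finally, the
  spectral measures are chosen separately for each \<open>\<omega>\<close>, so measurability of
  their values on Borel sets has to be proved along with the mixture formula, starting from the
  moments.\<close>

lemma summable_on_le:
  fixes f g :: "'x \<Rightarrow> real"
  assumes "g summable_on X" "\<And>x. f x \<le> g x" "\<And>x. 0 \<le> f x"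
  shows "f summable_on X"
  using Infinite_Sum.abs_summable_on_comparison_test'[OF assms(1), of f] assms(2,3) by simp

lemma ell2_prod_summable:
  assumes "f \<in> ell2 X" "g \<in> ell2 X"
  shows "(\<lambda>x. f x * cnj (g x)) summable_on X"
proof -
  have "(\<lambda>x. (cmod (f x))\<^sup>2 + (cmod (g x))\<^sup>2) summable_on X"
    using assms by (intro summable_on_add) (auto simp: ell2_def)
  moreover have "cmod (f x * cnj (g x)) \<le> (cmod (f x))\<^sup>2 + (cmod (g x))\<^sup>2" for x
  proof -
    have "2 * (cmod (f x) * cmod (g x)) \<le> (cmod (f x))\<^sup>2 + (cmod (g x))\<^sup>2"
      using sum_squares_bound[of "cmod (f x)" "cmod (g x)"] by simp
    moreover have "0 \<le> cmod (f x) * cmod (g x)" by simp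
    ultimately show ?thesis unfolding norm_mult complex_mod_cnj by linarith
  qed
  ultimately have "(\<lambda>x. cmod (f x * cnj (g x))) summable_on X"
    by (rule summable_on_le) simp
  then show ?thesis by (rule abs_summable_summable)
qed

lemma ell2_lincomb:
  assumes "f \<in> ell2 X" "g \<in> ell2 X"
  shows "(\<lambda>x. a * f x + b * g x) \<in> ell2 X"
proof -
  have "(\<lambda>x. 2 * (cmod a)\<^sup>2 * (cmod (f x))\<^sup>2 + 2 * (cmod b)\<^sup>2 * (cmod (g x))\<^sup>2) summable_on X"
    using assms by (intro summable_on_add summable_on_cmult_right) (auto simp: ell2_def)
  moreover have "(cmod (a * f x + b * g x))\<^sup>2
      \<le> 2 * (cmod a)\<^sup>2 * (cmod (f x))\<^sup>2 + 2 * (cmod b)\<^sup>2 * (cmod (g x))\<^sup>2" for x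
  proof -
    have "(cmod (a * f x + b * g x))\<^sup>2 \<le> (cmod (a * f x) + cmod (b * g x))\<^sup>2"
      by (intro power_mono norm_triangle_ineq) auto
    also have "\<dots> \<le> 2 * (cmod (a * f x))\<^sup>2 + 2 * (cmod (b * g x))\<^sup>2"
      using sum_squares_bound[of "cmod (a * f x)" "cmod (b * g x)"] by (simp add: power2_sum)
    finally show ?thesis by (simp add: norm_mult power_mult_distrib)
  qed
  ultimately have "(\<lambda>x. (cmod (a * f x + b * g x))\<^sup>2) summable_on X"
    by (rule summable_on_le) simp
  then show ?thesis using assms by (auto simp: ell2_def)
qed

lemma ell2_scale: "f \<in> ell2 X \<Longrightarrow> (\<lambda>x. a * f x) \<in> ell2 X"
  using ell2_lincomb[of f X f a 0] by simp

lemma ell2_diff: "f \<in> ell2 X \<Longrightarrow> g \<in> ell2 X \<Longrightarrow> (\<lambda>x. f x - g x) \<in> ell2 X"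
  using ell2_lincomb[of f X g 1 "-1"] by simp

lemma ell2_zero: "(\<lambda>x. 0) \<in> ell2 X"
  by (simp add: ell2_def)

lemma ell2_sum:
  assumes "finite J" "\<And>j. j \<in> J \<Longrightarrow> f j \<in> ell2 X"
  shows "(\<lambda>x. \<Sum>j\<in>J. f j x) \<in> ell2 X"
  using assms
proof (induction J rule: finite_induct)
  case (insert j J)
  then show ?case using ell2_lincomb[of "f j" X "\<lambda>x. \<Sum>j\<in>J. f j x" 1 1] by simp
qed (simp add: ell2_zero)

lemma delta_ell2: "x \<in> X \<Longrightarrow> delta x \<in> ell2 X"
  unfolding ell2_def
proof (intro CollectI conjI allI impI)
  assume "x \<in> X"
  have "(\<lambda>y. (cmod (delta x y))\<^sup>2) summable_on {x}" by simp
  then show "(\<lambda>y. (cmod (delta x y))\<^sup>2) summable_on X"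
    by (rule summable_on_cong_neutral[THEN iffD1, rotated -1])
       (use \<open>x \<in> X\<close> in \<open>auto simp: delta_def split: if_splits\<close>)
qed (auto simp: delta_def)

lemma ell2_inner_lincomb:
  assumes "f \<in> ell2 X" "g \<in> ell2 X" "h \<in> ell2 X"
  shows "ell2_inner X (\<lambda>x. a * f x + b * g x) h = a * ell2_inner X f h + b * ell2_inner X g h"
proof -
  have "ell2_inner X (\<lambda>x. a * f x + b * g x) h
      = (\<Sum>\<^sub>\<infinity>x\<in>X. a * (f x * cnj (h x)) + b * (g x * cnj (h x)))"
    by (simp add: ell2_inner_def algebra_simps)
  also have "\<dots> = (\<Sum>\<^sub>\<infinity>x\<in>X. a * (f x * cnj (h x))) + (\<Sum>\<^sub>\<infinity>x\<in>X. b * (g x * cnj (h x)))"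
    by (intro infsum_add summable_on_cmult_right ell2_prod_summable assms)
  also have "\<dots> = a * ell2_inner X f h + b * ell2_inner X g h"
    by (simp add: ell2_inner_def infsum_cmult_right' ell2_prod_summable assms)
  finally show ?thesis .
qed

lemma ell2_inner_commute: "ell2_inner X g f = cnj (ell2_inner X f g)"
  unfolding ell2_inner_def by (subst infsum_cnj [symmetric]) (simp add: mult.commute)

lemma ell2_inner_lincomb_right:
  assumes "f \<in> ell2 X" "g \<in> ell2 X" "h \<in> ell2 X"
  shows "ell2_inner X h (\<lambda>x. a * f x + b * g x)
    = cnj a * ell2_inner X h f + cnj b * ell2_inner X h g"
  unfolding ell2_inner_commute[of X h] ell2_inner_lincomb[OF assms] by simp

lemma ell2_inner_sum:
  assumes "finite J" "\<And>j. j \<in> J \<Longrightarrow> f j \<in> ell2 X" "h \<in> ell2 X"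
  shows "ell2_inner X (\<lambda>x. \<Sum>j\<in>J. c j * f j x) h = (\<Sum>j\<in>J. c j * ell2_inner X (f j) h)"
  using assms(1,2)
proof (induction J rule: finite_induct)
  case empty
  then show ?case by (simp add: ell2_inner_def)
next
  case (insert j J)
  have "(\<lambda>x. \<Sum>j\<in>J. c j * f j x) \<in> ell2 X"
    using insert by (intro ell2_sum ell2_scale) auto
  then show ?case
    using insert ell2_inner_lincomb[of "f j" X "\<lambda>x. \<Sum>j\<in>J. c j * f j x" h "c j" 1] assms(3) by simp
qed

text \<open>Summability can be left out: \<open>Re\<close> is a bounded left inverse of the
  embedding, so both families are summable or neither is, and in the latter case both sums are
  0.\<close>

lemma infsum_of_real_complex: "(\<Sum>\<^sub>\<infinity>x\<in>X. complex_of_real (f x)) = of_real (infsum f X)"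
proof (rule infsum_bounded_linear_strong)
  show "(\<lambda>x. complex_of_real (f x)) summable_on X \<longleftrightarrow> f summable_on X"
    by (rule summable_on_bounded_linear_iff[where h' = Re]) (auto intro: bounded_linear_of_real bounded_linear_Re)
qed (rule bounded_linear_of_real)

lemma ell2_inner_self: "ell2_inner X f f = of_real (\<Sum>\<^sub>\<infinity>x\<in>X. (cmod (f x))\<^sup>2)"
  unfolding ell2_inner_def infsum_of_real_complex[symmetric]
  by (intro infsum_cong) (simp add: complex_norm_square del: of_real_power)

lemma Re_ell2_inner_self_nonneg: "0 \<le> Re (ell2_inner X f f)"
  by (simp add: ell2_inner_self infsum_nonneg)

lemma ell2_inner_delta:
  assumes "x \<in> X"
  shows "ell2_inner X f (delta x) = f x"
proof -
  have "ell2_inner X f (delta x) = (\<Sum>\<^sub>\<infinity>y\<in>{x}. f y * cnj (delta x y))"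
    unfolding ell2_inner_def using assms
    by (intro infsum_cong_neutral) (auto simp: delta_def)
  then show ?thesis by (simp add: delta_def)
qed

text \<open>No boundedness is recorded. The norm estimates that are needed come from quadratic forms
  and integrals against the diagonal measures.\<close>

definition linear_on_ell2 :: "'x set \<Rightarrow> (('x \<Rightarrow> complex) \<Rightarrow> 'x \<Rightarrow> complex) \<Rightarrow> bool"
  where "linear_on_ell2 X T \<longleftrightarrow>
    (\<forall>f\<in>ell2 X. T f \<in> ell2 X) \<and>
    (\<forall>f\<in>ell2 X. \<forall>g\<in>ell2 X. \<forall>a b. T (\<lambda>x. a * f x + b * g x) = (\<lambda>x. a * T f x + b * T g x))"

lemma linear_on_ell2D:
  assumes "linear_on_ell2 X T"
  shows "f \<in> ell2 X \<Longrightarrow> T f \<in> ell2 X"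
    and "f \<in> ell2 X \<Longrightarrow> g \<in> ell2 X \<Longrightarrow> T (\<lambda>x. a * f x + b * g x) = (\<lambda>x. a * T f x + b * T g x)"
  using assms unfolding linear_on_ell2_def by blast+

lemma linear_on_ell2_power:
  "linear_on_ell2 X T \<Longrightarrow> f \<in> ell2 X \<Longrightarrow> (T ^^ n) f \<in> ell2 X"
  by (induction n) (auto dest: linear_on_ell2D)

lemma linear_on_ell2_sum:
  assumes T: "linear_on_ell2 X T" and "finite J" "\<And>j. j \<in> J \<Longrightarrow> f j \<in> ell2 X"
  shows "T (\<lambda>x. \<Sum>j\<in>J. c j * f j x) = (\<lambda>x. \<Sum>j\<in>J. c j * T (f j) x)"
  using assms(2,3)
proof (induction J rule: finite_induct)
  case empty
  show ?case using linear_on_ell2D(2)[OF T ell2_zero ell2_zero, of 0 0] by simp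
next
  case (insert j J)
  have "(\<lambda>x. \<Sum>j\<in>J. c j * f j x) \<in> ell2 X"
    using insert by (intro ell2_sum ell2_scale) auto
  then show ?case
    using insert linear_on_ell2D(2)[OF T, of "f j" "\<lambda>x. \<Sum>j\<in>J. c j * f j x" "c j" 1] by simp
qed

lemma linear_on_ell2_lincomb:
  assumes "linear_on_ell2 X S" "linear_on_ell2 X T"
  shows "linear_on_ell2 X (\<lambda>f x. a * S f x + b * T f x)"
  unfolding linear_on_ell2_def
  using linear_on_ell2D[OF assms(1)] linear_on_ell2D[OF assms(2)]
  by (auto intro!: ell2_lincomb simp: algebra_simps)

lemma linear_on_ell2_sumI:
  assumes "finite J" "\<And>j. j \<in> J \<Longrightarrow> linear_on_ell2 X (T j)"
  shows "linear_on_ell2 X (\<lambda>f x. \<Sum>j\<in>J. c j * T j f x)"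
  using assms
proof (induction J rule: finite_induct)
  case empty
  then show ?case by (simp add: linear_on_ell2_def ell2_zero)
next
  case (insert j J)
  then show ?case
    using linear_on_ell2_lincomb[of X "T j" "\<lambda>f x. \<Sum>j\<in>J. c j * T j f x" "c j" 1] by simp
qed

section \<open>Norm estimates from quadratic forms\<close>

lemma Re_ell2_inner_add:
  assumes "f \<in> ell2 X" "g \<in> ell2 X"
  shows "Re (ell2_inner X (\<lambda>x. f x + g x) (\<lambda>x. f x + g x)) =
    Re (ell2_inner X f f) + Re (ell2_inner X g g) + 2 * Re (ell2_inner X f g)"
proof -
  have s: "(\<lambda>x. f x + g x) \<in> ell2 X" using ell2_lincomb[OF assms, of 1 1] by simp
  show ?thesis
    using ell2_inner_lincomb[OF assms s, of 1 1] ell2_inner_lincomb_right[OF assms assms(1), of 1 1]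
      ell2_inner_lincomb_right[OF assms assms(2), of 1 1] ell2_inner_commute[of X f g]
    by simp
qed

lemma Re_ell2_inner_diff:
  assumes "f \<in> ell2 X" "g \<in> ell2 X"
  shows "Re (ell2_inner X (\<lambda>x. f x - g x) (\<lambda>x. f x - g x)) =
    Re (ell2_inner X f f) + Re (ell2_inner X g g) - 2 * Re (ell2_inner X f g)"
  using Re_ell2_inner_add[OF assms(1) ell2_scale[OF assms(2), of "-1"]]
    ell2_inner_lincomb_right[OF assms(2) assms(2) assms(1), of "-1" 0]
    ell2_inner_lincomb_right[OF assms(2) assms(2) ell2_scale[OF assms(2), of "-1"], of "-1" 0]
    ell2_inner_lincomb[OF assms(2) assms(2) assms(2), of "-1" 0]
  by simp

text \<open>The parallelogram identity with the square of the difference dropped; it serves as a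
  triangle inequality for squared norms.\<close>

lemma ell2_norm_add_le:
  assumes "f \<in> ell2 X" "g \<in> ell2 X"
  shows "Re (ell2_inner X (\<lambda>x. f x + g x) (\<lambda>x. f x + g x)) \<le>
    2 * Re (ell2_inner X f f) + 2 * Re (ell2_inner X g g)"
  using Re_ell2_inner_add[OF assms] Re_ell2_inner_diff[OF assms]
    Re_ell2_inner_self_nonneg[of X "\<lambda>x. f x - g x"] by linarith

lemma ell2_Cauchy_Schwarz:
  assumes f: "f \<in> ell2 X" and g: "g \<in> ell2 X"
  shows "(Re (ell2_inner X f g))\<^sup>2 \<le> Re (ell2_inner X f f) * Re (ell2_inner X g g)"
proof -
  let ?a = "Re (ell2_inner X f f)" and ?b = "Re (ell2_inner X f g)" and ?c = "Re (ell2_inner X g g)"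
  \<comment> \<open>The squared norm of f - s g for real s, a polynomial of degree at most 2 in s
    that is never negative.\<close>
  have q: "0 \<le> ?a + s\<^sup>2 * ?c - 2 * s * ?b" for s
  proof -
    note sg = ell2_scale[OF g, of "complex_of_real s"]
    have "Re (ell2_inner X f (\<lambda>x. of_real s * g x)) = s * ?b"
      using ell2_inner_lincomb_right[OF g g f, of "of_real s" 0] by simp
    moreover have "Re (ell2_inner X (\<lambda>x. of_real s * g x) (\<lambda>x. of_real s * g x)) = s\<^sup>2 * ?c"
      using ell2_inner_lincomb_right[OF g g sg, of "of_real s" 0]
        ell2_inner_lincomb[OF g g g, of "of_real s" 0] by (simp add: power2_eq_square)
    ultimately show ?thesis
      using Re_ell2_inner_diff[OF f sg]
        Re_ell2_inner_self_nonneg[of X "\<lambda>x. f x - of_real s * g x"] by simp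
  qed
  show ?thesis
  proof (cases "?c = 0")
    case True
    have "?b = 0"
    proof (rule ccontr)
      assume "?b \<noteq> 0"
      \<comment> \<open>With \<open>?c = 0\<close> the polynomial is affine; this s gives it the
        value -1.\<close>
      then have "2 * ((?a + 1) / (2 * ?b)) * ?b = ?a + 1" by simp
      with q[of "(?a + 1) / (2 * ?b)"] True show False by simp
    qed
    with True show ?thesis by simp
  next
    case False
    then have c: "?c > 0" using Re_ell2_inner_self_nonneg[of X g] by simp
    \<comment> \<open>s = \<open>?b / ?c\<close> minimizes the polynomial; the factor
      \<open>?c\<close> clears denominators.\<close>
    have "0 \<le> ?c * (?a + (?b / ?c)\<^sup>2 * ?c - 2 * (?b / ?c) * ?b)"
      using c q[of "?b / ?c"] by (intro mult_nonneg_nonneg) auto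
    also have "\<dots> = ?a * ?c - ?b\<^sup>2" using c by (simp add: field_simps power2_eq_square)
    finally show ?thesis by simp
  qed
qed

text \<open>Over the complex numbers a real quadratic form already forces the operator to be symmetric.\<close>

lemma quadratic_form_symmetric:
  assumes A: "linear_on_ell2 X A"
    and re: "\<And>f. f \<in> ell2 X \<Longrightarrow> Im (ell2_inner X (A f) f) = 0"
    and f: "f \<in> ell2 X" and g: "g \<in> ell2 X"
  shows "Re (ell2_inner X (A f) g) = Re (ell2_inner X (A g) f)"
proof -
  note Af = linear_on_ell2D(1)[OF A f] and Ag = linear_on_ell2D(1)[OF A g]
  \<comment> \<open>The factor \<i> moves the real parts of the two cross terms, with opposite
    signs, into the imaginary part of the form at \<open>?h\<close>, which vanishes.\<close>
  let ?h = "\<lambda>x. 1 * f x + \<i> * g x"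
  have h: "?h \<in> ell2 X" by (intro ell2_lincomb f g)
  have "ell2_inner X (A ?h) ?h = 1 * ell2_inner X (A f) ?h + \<i> * ell2_inner X (A g) ?h"
    unfolding linear_on_ell2D(2)[OF A f g] by (rule ell2_inner_lincomb[OF Af Ag h])
  then have "Im (ell2_inner X (A ?h) ?h) = Im (ell2_inner X (A f) f) + Im (ell2_inner X (A g) g)
      + (Re (ell2_inner X (A g) f) - Re (ell2_inner X (A f) g))"
    by (simp only: ell2_inner_lincomb_right[OF f g Af] ell2_inner_lincomb_right[OF f g Ag]) simp
  then show ?thesis using re[OF h] re[OF f] re[OF g] by linarith
qed

text \<open>For a symmetric operator the norm is the supremum of the quadratic form on unit vectors.
  Polarization writes 4 Re <A f, g> as the form at f + g minus the form at f - g, the parallelogram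
  identity bounds this difference, and g is then chosen parallel to A f.\<close>

lemma quadratic_form_bound:
  assumes A: "linear_on_ell2 X A" and d: "d > 0"
    and re: "\<And>f. f \<in> ell2 X \<Longrightarrow> Im (ell2_inner X (A f) f) = 0"
    and bd: "\<And>f. f \<in> ell2 X \<Longrightarrow> \<bar>Re (ell2_inner X (A f) f)\<bar> \<le> d * Re (ell2_inner X f f)"
    and f: "f \<in> ell2 X"
  shows "Re (ell2_inner X (A f) (A f)) \<le> d\<^sup>2 * Re (ell2_inner X f f)"
proof -
  have pol: "2 * Re (ell2_inner X (A f) g) \<le> d * (Re (ell2_inner X f f) + Re (ell2_inner X g g))"
    if g: "g \<in> ell2 X" for g
  proof -
    note Af = linear_on_ell2D(1)[OF A f] and Ag = linear_on_ell2D(1)[OF A g]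
    have p: "(\<lambda>x. f x + g x) \<in> ell2 X" using ell2_lincomb[OF f g, of 1 1] by simp
    have m: "(\<lambda>x. f x - g x) \<in> ell2 X" using ell2_diff[OF f g] .
    have "Re (ell2_inner X (A (\<lambda>x. f x + g x)) (\<lambda>x. f x + g x)) =
        Re (ell2_inner X (A f) f) + Re (ell2_inner X (A g) g)
        + Re (ell2_inner X (A f) g) + Re (ell2_inner X (A g) f)"
      using linear_on_ell2D(2)[OF A f g, of 1 1] ell2_inner_lincomb[OF Af Ag p, of 1 1]
        ell2_inner_lincomb_right[OF f g Af, of 1 1] ell2_inner_lincomb_right[OF f g Ag, of 1 1]
      by simp
    moreover have "Re (ell2_inner X (A (\<lambda>x. f x - g x)) (\<lambda>x. f x - g x)) =
        Re (ell2_inner X (A f) f) + Re (ell2_inner X (A g) g)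
        - Re (ell2_inner X (A f) g) - Re (ell2_inner X (A g) f)"
      using linear_on_ell2D(2)[OF A f g, of 1 "-1"] ell2_inner_lincomb[OF Af Ag m, of 1 "-1"]
        ell2_inner_lincomb_right[OF f g Af, of 1 "-1"] ell2_inner_lincomb_right[OF f g Ag, of 1 "-1"]
      by simp
    ultimately have "4 * Re (ell2_inner X (A f) g) =
        Re (ell2_inner X (A (\<lambda>x. f x + g x)) (\<lambda>x. f x + g x))
        - Re (ell2_inner X (A (\<lambda>x. f x - g x)) (\<lambda>x. f x - g x))"
      using quadratic_form_symmetric[OF A re f g] by simp
    also have "\<dots> \<le> d * Re (ell2_inner X (\<lambda>x. f x + g x) (\<lambda>x. f x + g x))
        + d * Re (ell2_inner X (\<lambda>x. f x - g x) (\<lambda>x. f x - g x))"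
      using bd[OF p] bd[OF m] by linarith
    also have "\<dots> = 2 * (d * (Re (ell2_inner X f f) + Re (ell2_inner X g g)))"
      unfolding Re_ell2_inner_add[OF f g] Re_ell2_inner_diff[OF f g] by (simp add: algebra_simps)
    finally show ?thesis by linarith
  qed
  note Af = linear_on_ell2D(1)[OF A f]
  \<comment> \<open>With g = A f / d, \<open>pol\<close> reads 2 q / d \<le> d |f|^2 + q / d, where
    q = |A f|^2, and half of the left side cancels.\<close>
  let ?s = "complex_of_real (1 / d)" and ?q = "Re (ell2_inner X (A f) (A f))"
  have g: "(\<lambda>x. ?s * A f x) \<in> ell2 X" by (intro ell2_scale Af)
  have "ell2_inner X (A f) (\<lambda>x. ?s * A f x) = ?s * ell2_inner X (A f) (A f)"
    using ell2_inner_lincomb_right[OF Af Af Af, of ?s 0] by simp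
  moreover have "ell2_inner X (\<lambda>x. ?s * A f x) (\<lambda>x. ?s * A f x) = ?s * (?s * ell2_inner X (A f) (A f))"
    using ell2_inner_lincomb_right[OF Af Af g, of ?s 0] ell2_inner_lincomb[OF Af Af Af, of ?s 0] by simp
  ultimately have "2 * (?q / d) \<le> d * (Re (ell2_inner X f f) + ?q / d / d)"
    using pol[OF g] by simp
  then have "?q / d \<le> d * Re (ell2_inner X f f)"
    using d by (simp add: algebra_simps)
  then show ?thesis using d by (simp add: field_simps power2_eq_square)
qed


subsection \<open>Moments of a resolution of the identity\<close>

lemma floor_approx:
  assumes "0 < N"
  shows "\<bar>real_of_int \<lfloor>real N * t\<rfloor> / real N - t\<bar> \<le> 1 / real N"
proof -
  have "real N * t - 1 \<le> of_int \<lfloor>real N * t\<rfloor>" "of_int \<lfloor>real N * t\<rfloor> \<le> real N * t" by linarith+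
  then have "\<bar>real_of_int \<lfloor>real N * t\<rfloor> - real N * t\<bar> \<le> 1" by linarith
  then have "\<bar>real_of_int \<lfloor>real N * t\<rfloor> - real N * t\<bar> / real N \<le> 1 / real N"
    by (intro divide_right_mono) auto
  moreover have "real_of_int \<lfloor>real N * t\<rfloor> / real N - t = (real_of_int \<lfloor>real N * t\<rfloor> - real N * t) / real N"
    using assms by (simp add: field_simps)
  ultimately show ?thesis using assms by simp
qed

lemma tendsto_0_le_squeeze:
  fixes a b :: "nat \<Rightarrow> real"
  assumes "\<And>n. 0 \<le> a n" "\<And>n. a n \<le> b n" "b \<longlonglongrightarrow> 0"
  shows "a \<longlonglongrightarrow> 0"
  using assms by (intro tendsto_sandwich[OF _ _ tendsto_const assms(3)]) auto

text \<open>\<open>resolution_of_identity\<close> sees \<open>T\<close> only through the form f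
  \<mapsto> <T f, f>, so linearity and invariance of \<open>ell2 X\<close> are assumed separately;
  they make polarization available.\<close>

locale spectral_resolution =
  fixes X :: "'x set" and T and E
  assumes resolution: "resolution_of_identity X T E"
    and linear_T: "linear_on_ell2 X T"
begin

abbreviation "spec \<equiv> diagonal_measure X E"

lemmas resolution_conjs = resolution [unfolded resolution_of_identity_def]

lemma E_projection: "B \<in> sets borel \<Longrightarrow> orthogonal_projection X (E B)"
  by (rule bspec[OF resolution_conjs[THEN conjunct1]])

lemma E_linear: "B \<in> sets borel \<Longrightarrow> linear_on_ell2 X (E B)"
  using E_projection[of B] by (simp add: orthogonal_projection_def linear_on_ell2_def)

lemma E_ell2: "B \<in> sets borel \<Longrightarrow> f \<in> ell2 X \<Longrightarrow> E B f \<in> ell2 X"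
  using linear_on_ell2D(1)[OF E_linear] .

lemma E_adjoint:
  "B \<in> sets borel \<Longrightarrow> f \<in> ell2 X \<Longrightarrow> g \<in> ell2 X \<Longrightarrow> ell2_inner X (E B f) g = ell2_inner X f (E B g)"
  using E_projection[of B] by (simp add: orthogonal_projection_def)

lemma E_bounded_support: "\<exists>r. \<forall>f\<in>ell2 X. E {-r..r} f = f"
  by (rule resolution_conjs[THEN conjunct2, THEN conjunct1])

lemma E_Int:
  "A \<in> sets borel \<Longrightarrow> B \<in> sets borel \<Longrightarrow> f \<in> ell2 X \<Longrightarrow> E A (E B f) = E (A \<inter> B) f"
  using resolution_conjs[THEN conjunct2, THEN conjunct2, THEN conjunct1] by simp

lemma E_sums:
  assumes "range A \<subseteq> sets borel" "disjoint_family A" "f \<in> ell2 X" "g \<in> ell2 X"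
  shows "(\<lambda>i. ell2_inner X (E (A i) f) g) sums ell2_inner X (E (\<Union>i. A i) f) g"
  using resolution_conjs[THEN conjunct2, THEN conjunct2, THEN conjunct2, THEN conjunct1] assms by blast

lemma T_weak:
  assumes "f \<in> ell2 X"
  shows "integrable (spec f) (\<lambda>t. t)"
    and "ell2_inner X (T f) f = complex_of_real (\<integral>t. t \<partial>spec f)"
  using resolution_conjs[THEN conjunct2, THEN conjunct2, THEN conjunct2, THEN conjunct2] assms by simp_all

text \<open>Normalization comes from the bounded support: \<open>{-r..r}\<close> already acts as the
  identity, and intersecting it with \<open>UNIV\<close> changes nothing.\<close>

lemma E_UNIV: "f \<in> ell2 X \<Longrightarrow> E UNIV f = f"
proof -
  assume f: "f \<in> ell2 X"
  obtain r where r: "E {-r..r} f = f" using E_bounded_support f by metis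
  show ?thesis using E_Int[OF _ _ f, of UNIV "{-r..r}"] r by simp
qed

lemma E_empty:
  assumes "f \<in> ell2 X" "g \<in> ell2 X"
  shows "ell2_inner X (E {} f) g = 0"
proof -
  \<comment> \<open>Countably many copies of the empty set are disjoint; a constant series converges
    only if its term is 0.\<close>
  have "(\<lambda>i::nat. ell2_inner X (E {} f) g) sums ell2_inner X (E (\<Union>i::nat. {}) f) g"
    using assms by (intro E_sums) (auto simp: disjoint_family_on_def)
  then show ?thesis using summable_const_iff sums_summable by blast
qed

text \<open>A self-adjoint idempotent has the squared norm of its image as quadratic form. This
  makes the diagonal set function real and nonnegative.\<close>

lemma E_inner_self:
  assumes "B \<in> sets borel" "f \<in> ell2 X"
  shows "ell2_inner X (E B f) f = ell2_inner X (E B f) (E B f)"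
  using E_Int[OF assms(1,1,2)] E_adjoint[OF assms(1) E_ell2[OF assms] assms(2)] by simp

lemma Re_E_nonneg:
  "B \<in> sets borel \<Longrightarrow> f \<in> ell2 X \<Longrightarrow> 0 \<le> Re (ell2_inner X (E B f) f)"
  using Re_ell2_inner_self_nonneg by (simp add: E_inner_self)

lemma Im_E: "B \<in> sets borel \<Longrightarrow> f \<in> ell2 X \<Longrightarrow> Im (ell2_inner X (E B f) f) = 0"
  by (simp add: E_inner_self ell2_inner_self)

lemma sets_spec [simp, measurable_cong]: "sets (spec f) = sets borel"
  using sets.sigma_sets_eq[of "borel :: real measure"] by (simp add: diagonal_measure_def)

lemma space_spec [simp]: "space (spec f) = UNIV"
  by (simp add: diagonal_measure_def space_measure_of_conv)

text \<open>\<open>measure_of\<close> returns the given set function only if that function is a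
  measure. Countable additivity is the weak additivity of \<open>E\<close> with both vectors equal
  to \<open>f\<close>.\<close>

lemma emeasure_spec:
  assumes f: "f \<in> ell2 X" and B: "B \<in> sets borel"
  shows "emeasure (spec f) B = ennreal (Re (ell2_inner X (E B f) f))"
proof (rule emeasure_measure_of[OF diagonal_measure_def])
  show "positive (sets (spec f)) (\<lambda>B. ennreal (Re (ell2_inner X (E B f) f)))"
    by (simp add: positive_def E_empty[OF f f])
  show "countably_additive (sets (spec f)) (\<lambda>B. ennreal (Re (ell2_inner X (E B f) f)))"
  proof (rule countably_additiveI)
    fix A :: "nat \<Rightarrow> real set"
    assume A: "range A \<subseteq> sets (spec f)" "disjoint_family A"
    then have "(\<lambda>i. Re (ell2_inner X (E (A i) f) f)) sums Re (ell2_inner X (E (\<Union>i. A i) f) f)"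
      by (intro sums_Re E_sums) (auto simp: f)
    then show "(\<Sum>i. ennreal (Re (ell2_inner X (E (A i) f) f)))
        = ennreal (Re (ell2_inner X (E (\<Union>i. A i) f) f))"
      using A by (intro suminf_ennreal_eq) (auto intro!: Re_E_nonneg f)
  qed
qed (use B in auto)

lemma measure_spec:
  "f \<in> ell2 X \<Longrightarrow> B \<in> sets borel \<Longrightarrow> measure (spec f) B = Re (ell2_inner X (E B f) f)"
  by (simp add: measure_def emeasure_spec Re_E_nonneg)

lemma finite_measure_spec: "f \<in> ell2 X \<Longrightarrow> finite_measure (spec f)"
  by (intro finite_measureI) (simp add: emeasure_spec)

lemma measure_spec_UNIV: "f \<in> ell2 X \<Longrightarrow> measure (spec f) UNIV = Re (ell2_inner X f f)"
  by (simp add: measure_spec E_UNIV)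

lemma AE_spec_bounded: "\<exists>r>0. \<forall>f\<in>ell2 X. AE t in spec f. \<bar>t\<bar> \<le> r"
proof -
  obtain r where r: "\<And>f. f \<in> ell2 X \<Longrightarrow> E {-r..r} f = f" using E_bounded_support by blast
  \<comment> \<open>Enlarging to \<open>\<bar>r\<bar> + 1\<close> makes the radius positive whatever
    the sign of \<open>r\<close>.\<close>
  have "AE t in spec f. \<bar>t\<bar> \<le> \<bar>r\<bar> + 1" if f: "f \<in> ell2 X" for f
  proof -
    interpret finite_measure "spec f" by (rule finite_measure_spec[OF f])
    have "measure (spec f) (UNIV - {-r..r}) = measure (spec f) UNIV - measure (spec f) {-r..r}"
      using finite_measure_compl[of "{-r..r}"] by simp
    also have "\<dots> = 0" using f by (simp add: measure_spec E_UNIV r)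
    finally have "emeasure (spec f) (UNIV - {-r..r}) = 0" by (simp add: emeasure_eq_measure)
    then have "AE t in spec f. t \<notin> UNIV - {-r..r}" by (intro AE_not_in) (auto simp: null_sets_def)
    then show ?thesis by eventually_elim auto
  qed
  then show ?thesis by (intro exI[of _ "\<bar>r\<bar> + 1"]) auto
qed

lemma integrable_spec_bounded:
  assumes f: "f \<in> ell2 X" and g: "g \<in> borel_measurable borel"
    and bd: "\<And>t. \<bar>t\<bar> \<le> r \<Longrightarrow> \<bar>g t\<bar> \<le> (c::real)" and r: "AE t in spec f. \<bar>t\<bar> \<le> r"
  shows "integrable (spec f) g"
proof -
  interpret finite_measure "spec f" by (rule finite_measure_spec[OF f])
  show ?thesis
    using r bd g by (intro integrable_const_bound[of _ c]) (auto elim!: eventually_mono)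
qed

text \<open>The functional calculus for step functions that are constant on the cells
  \<open>[j/N, (j+1)/N)\<close>.\<close>

definition cell :: "nat \<Rightarrow> int \<Rightarrow> real set"
  where "cell N j = {t. \<lfloor>real N * t\<rfloor> = j}"

definition step_op :: "nat \<Rightarrow> int set \<Rightarrow> (int \<Rightarrow> real) \<Rightarrow> ('x \<Rightarrow> complex) \<Rightarrow> 'x \<Rightarrow> complex"
  where "step_op N J \<phi> f = (\<lambda>x. \<Sum>j\<in>J. complex_of_real (\<phi> j) * E (cell N j) f x)"

lemma cell_borel [measurable, simp]: "cell N j \<in> sets borel"
  unfolding cell_def by measurable

lemma cell_Int: "cell N i \<inter> cell N j = (if i = j then cell N i else {})"
  by (auto simp: cell_def)

lemma step_op_linear: "finite J \<Longrightarrow> linear_on_ell2 X (step_op N J \<phi>)"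
  unfolding step_op_def by (intro linear_on_ell2_sumI E_linear) auto

text \<open>Weak vanishing becomes pointwise vanishing by testing against point masses.\<close>

lemma E_empty_eq: "f \<in> ell2 X \<Longrightarrow> E {} f = (\<lambda>x. 0)"
proof
  fix x assume f: "f \<in> ell2 X"
  have e: "E {} f \<in> ell2 X" by (simp add: E_ell2 f)
  show "E {} f x = 0"
  proof (cases "x \<in> X")
    case True
    then show ?thesis using E_empty[OF f delta_ell2[OF True]] by (simp add: ell2_inner_delta)
  next
    case False
    then show ?thesis using e by (simp add: ell2_def)
  qed
qed

text \<open>Different cells are disjoint, so their projections annihilate each other and only
  diagonal terms survive. Hence powers of a step operator are step operators of the powers.\<close>

lemma step_op_mult:
  assumes J: "finite J" and f: "f \<in> ell2 X"
  shows "step_op N J \<phi> (step_op N J \<psi> f) = step_op N J (\<lambda>j. \<phi> j * \<psi> j) f"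
proof -
  have "E (cell N i) (\<lambda>x. \<Sum>j\<in>J. complex_of_real (\<psi> j) * E (cell N j) f x)
      = (\<lambda>x. complex_of_real (\<psi> i) * E (cell N i) f x)" if i: "i \<in> J" for i
  proof -
    have "E (cell N i) (\<lambda>x. \<Sum>j\<in>J. complex_of_real (\<psi> j) * E (cell N j) f x)
       = (\<lambda>x. \<Sum>j\<in>J. complex_of_real (\<psi> j) * E (cell N i \<inter> cell N j) f x)"
      using linear_on_ell2_sum[OF E_linear J, of "cell N i" "\<lambda>j. E (cell N j) f"]
      by (simp add: E_ell2 f E_Int)
    also have "\<dots> = (\<lambda>x. \<Sum>j\<in>J. if i = j then complex_of_real (\<psi> i) * E (cell N i) f x else 0)"
      by (intro ext sum.cong) (auto simp: cell_Int E_empty_eq f)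
    also have "\<dots> = (\<lambda>x. complex_of_real (\<psi> i) * E (cell N i) f x)"
      using J i by simp
    finally show ?thesis .
  qed
  then show ?thesis
    unfolding step_op_def by (auto intro!: sum.cong simp: mult.assoc)
qed

lemma step_op_inner:
  assumes J: "finite J" and f: "f \<in> ell2 X"
  shows "ell2_inner X (step_op N J \<phi> f) f = complex_of_real (\<Sum>j\<in>J. \<phi> j * measure (spec f) (cell N j))"
proof -
  have "ell2_inner X (E (cell N j) f) f = complex_of_real (measure (spec f) (cell N j))" for j
    using Im_E[OF cell_borel f] by (simp add: measure_spec f complex_eq_iff)
  then show ?thesis
    unfolding step_op_def using ell2_inner_sum[OF J _ f, of "\<lambda>j. E (cell N j) f"]
    by (simp add: E_ell2 f)
qed

text \<open>A finite \<open>J\<close> is enough because cells outside it carry no mass of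
  \<open>spec f\<close>; up to a null set the integrand is a finite sum of indicators.\<close>

lemma step_op_integral:
  assumes J: "finite J" and f: "f \<in> ell2 X"
    and cover: "AE t in spec f. \<lfloor>real N * t\<rfloor> \<in> J"
  shows "integrable (spec f) (\<lambda>t. \<phi> \<lfloor>real N * t\<rfloor>)"
    and "ell2_inner X (step_op N J \<phi> f) f = complex_of_real (\<integral>t. \<phi> \<lfloor>real N * t\<rfloor> \<partial>spec f)"
proof -
  interpret finite_measure "spec f" by (rule finite_measure_spec[OF f])
  let ?s = "\<lambda>t. \<Sum>j\<in>J. \<phi> j * indicator (cell N j) t"
  have eq: "AE t in spec f. ?s t = \<phi> \<lfloor>real N * t\<rfloor>"
    using cover
  proof eventually_elim
    case (elim t)
    have "?s t = (\<Sum>j\<in>J. if j = \<lfloor>real N * t\<rfloor> then \<phi> j else 0)"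
      by (intro sum.cong) (auto simp: cell_def)
    then show ?case using elim J by simp
  qed
  have int: "integrable (spec f) ?s"
    by (intro Bochner_Integration.integrable_sum integrable_mult_right integrable_real_indicator)
       (auto simp: emeasure_eq_measure)
  show i2: "integrable (spec f) (\<lambda>t. \<phi> \<lfloor>real N * t\<rfloor>)"
    by (rule integrable_cong_AE_imp[OF int]) (use eq in \<open>auto elim: eventually_mono\<close>)
  have "(\<integral>t. \<phi> \<lfloor>real N * t\<rfloor> \<partial>spec f) = (\<integral>t. ?s t \<partial>spec f)"
    using eq int i2 by (intro integral_cong_AE) (auto elim: eventually_mono)
  also have "\<dots> = (\<Sum>j\<in>J. \<phi> j * measure (spec f) (cell N j))"
    by (subst Bochner_Integration.integral_sum)
       (auto intro!: integrable_mult_right integrable_real_indicator simp: emeasure_eq_measure)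
  finally show "ell2_inner X (step_op N J \<phi> f) f = complex_of_real (\<integral>t. \<phi> \<lfloor>real N * t\<rfloor> \<partial>spec f)"
    by (simp add: step_op_inner J f)
qed

lemma step_op_adjoint:
  assumes J: "finite J" and f: "f \<in> ell2 X" and g: "g \<in> ell2 X"
  shows "ell2_inner X (step_op N J \<phi> f) g = ell2_inner X f (step_op N J \<phi> g)"
proof -
  have "ell2_inner X (step_op N J \<phi> f) g = (\<Sum>j\<in>J. complex_of_real (\<phi> j) * ell2_inner X f (E (cell N j) g))"
    unfolding step_op_def using ell2_inner_sum[OF J _ g, of "\<lambda>j. E (cell N j) f"]
    by (simp add: E_ell2 f g E_adjoint)
  also have "\<dots> = cnj (\<Sum>j\<in>J. complex_of_real (\<phi> j) * ell2_inner X (E (cell N j) g) f)"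
    by (simp add: ell2_inner_commute[of X f])
  also have "\<dots> = cnj (ell2_inner X (step_op N J \<phi> g) f)"
    unfolding step_op_def using ell2_inner_sum[OF J _ f, of "\<lambda>j. E (cell N j) g"]
    by (simp add: E_ell2 g)
  finally show ?thesis by (simp add: ell2_inner_commute[of X f])
qed

text \<open>A radius common to all vectors, fixed once and for all so that \<open>cells N\<close>,
  and with it the step operators, do not depend on \<open>f\<close>.\<close>

definition bd :: real
  where "bd = (SOME r. 0 < r \<and> (\<forall>f\<in>ell2 X. AE t in spec f. \<bar>t\<bar> \<le> r))"

lemma bd: "0 < bd" "f \<in> ell2 X \<Longrightarrow> AE t in spec f. \<bar>t\<bar> \<le> bd"
  using someI_ex[OF AE_spec_bounded, folded bd_def] by auto

abbreviation "cells N \<equiv> {\<lfloor>- real N * bd\<rfloor>..\<lfloor>real N * bd\<rfloor>}"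

text \<open>The integral of (floor(N t) / N)^n against \<open>E\<close>, approximating the n-th
  power of \<open>T\<close> with mesh 1/N.\<close>

abbreviation "T_step N n \<equiv> step_op N (cells N) (\<lambda>j. (real_of_int j / real N) ^ n)"

lemma cells_cover: "f \<in> ell2 X \<Longrightarrow> AE t in spec f. \<lfloor>real N * t\<rfloor> \<in> cells N"
  using bd(2)
proof (rule eventually_mono)
  fix t assume "\<bar>t\<bar> \<le> bd"
  then have "real N * (-bd) \<le> real N * t" "real N * t \<le> real N * bd"
    by (intro mult_left_mono; simp)+
  then show "\<lfloor>real N * t\<rfloor> \<in> cells N" by (auto intro: floor_mono)
qed

text \<open>The form of the difference at g is the integral of t - floor(N t) / N against
  \<open>spec g\<close>, hence real and at most |g|^2 / N in absolute value;
  \<open>quadratic_form_bound\<close> turns this into a norm bound.\<close>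

lemma T_step_close:
  assumes N: "0 < N" and f: "f \<in> ell2 X"
  shows "Re (ell2_inner X (\<lambda>x. T f x - T_step N 1 f x) (\<lambda>x. T f x - T_step N 1 f x))
    \<le> (1 / real N)\<^sup>2 * Re (ell2_inner X f f)"
proof -
  let ?A = "\<lambda>f x. 1 * T f x + (-1) * T_step N 1 f x"
  have A: "linear_on_ell2 X ?A"
    by (intro linear_on_ell2_lincomb linear_T step_op_linear) simp
  have form: "ell2_inner X (?A g) g
      = complex_of_real (\<integral>t. t - real_of_int \<lfloor>real N * t\<rfloor> / real N \<partial>spec g)"
    if g: "g \<in> ell2 X" for g
  proof -
    note int = step_op_integral[OF _ g cells_cover[OF g], of N "\<lambda>j. (real_of_int j / real N) ^ 1"]
    have "ell2_inner X (?A g) g = 1 * ell2_inner X (T g) g + (-1) * ell2_inner X (T_step N 1 g) g"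
      by (intro ell2_inner_lincomb linear_on_ell2D(1)[OF linear_T] linear_on_ell2D(1)[OF step_op_linear] g)
         simp
    then show ?thesis using int T_weak[OF g] by simp
  qed
  have "Re (ell2_inner X (?A f) (?A f)) \<le> (1 / real N)\<^sup>2 * Re (ell2_inner X f f)"
  proof (rule quadratic_form_bound[OF A])
    show "0 < 1 / real N" using N by simp
  next
    fix g assume g: "g \<in> ell2 X"
    interpret finite_measure "spec g" by (rule finite_measure_spec[OF g])
    show "Im (ell2_inner X (?A g) g) = 0" using form[OF g] by simp
    have "\<bar>\<integral>t. t - real_of_int \<lfloor>real N * t\<rfloor> / real N \<partial>spec g\<bar> \<le> (\<integral>t. 1 / real N \<partial>spec g)"
      using floor_approx[OF N] by (intro integral_abs_bound_integral T_weak(1)[OF g]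
        Bochner_Integration.integrable_diff)
       (auto simp: abs_minus_commute intro: step_op_integral(1)[OF _ g cells_cover[OF g], of N "\<lambda>j. real_of_int j / real N"])
    then show "\<bar>Re (ell2_inner X (?A g) g)\<bar> \<le> 1 / real N * Re (ell2_inner X g g)"
      using form[OF g] measure_spec_UNIV[OF g] by simp
  qed (rule f)
  then show ?thesis by simp
qed

text \<open>By self-adjointness and multiplicativity the squared norm is the integral of (floor(N t)
  / N)^2; the \<open>+ 1\<close> in \<open>bd + 1\<close> absorbs the rounding error 1/N. The point
  is that the bound is uniform in \<open>N\<close>.\<close>

lemma T_step_bound:
  assumes N: "0 < N" and f: "f \<in> ell2 X"
  shows "Re (ell2_inner X (T_step N 1 f) (T_step N 1 f)) \<le> (bd + 1)\<^sup>2 * Re (ell2_inner X f f)"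
proof -
  interpret finite_measure "spec f" by (rule finite_measure_spec[OF f])
  let ?\<phi> = "\<lambda>j. real_of_int j / real N * (real_of_int j / real N)"
  have s: "T_step N 1 f \<in> ell2 X" by (intro linear_on_ell2D(1)[OF step_op_linear] f) simp
  have "ell2_inner X (T_step N 1 f) (T_step N 1 f) = ell2_inner X (T_step N 1 (T_step N 1 f)) f"
    by (intro step_op_adjoint[symmetric] s f) simp
  also have "\<dots> = ell2_inner X (step_op N (cells N) ?\<phi> f) f"
    by (subst step_op_mult) (auto simp: f)
  also have "\<dots> = complex_of_real (\<integral>t. ?\<phi> \<lfloor>real N * t\<rfloor> \<partial>spec f)"
    by (rule step_op_integral(2)[OF _ f cells_cover[OF f]]) simp
  finally have "Re (ell2_inner X (T_step N 1 f) (T_step N 1 f)) = (\<integral>t. ?\<phi> \<lfloor>real N * t\<rfloor> \<partial>spec f)"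
    by (simp only: Re_complex_of_real)
  also have "(\<integral>t. ?\<phi> \<lfloor>real N * t\<rfloor> \<partial>spec f) \<le> (\<integral>t. (bd + 1)\<^sup>2 \<partial>spec f)"
  proof (rule integral_mono_AE)
    show "integrable (spec f) (\<lambda>t. ?\<phi> \<lfloor>real N * t\<rfloor>)"
      by (rule step_op_integral(1)[OF _ f cells_cover[OF f]]) simp
    show "AE t in spec f. ?\<phi> \<lfloor>real N * t\<rfloor> \<le> (bd + 1)\<^sup>2"
      using bd(2)[OF f]
    proof eventually_elim
      case (elim t)
      have "1 / real N \<le> 1" using N by simp
      then have "\<bar>real_of_int \<lfloor>real N * t\<rfloor> / real N\<bar> \<le> bd + 1"
        using floor_approx[OF N, of t] elim by linarith
      then have "\<bar>real_of_int \<lfloor>real N * t\<rfloor> / real N\<bar>\<^sup>2 \<le> (bd + 1)\<^sup>2"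
        by (intro power_mono) auto
      then show ?case by (simp add: power2_eq_square)
    qed
  qed simp
  finally show ?thesis using measure_spec_UNIV[OF f] by (simp add: mult.commute)
qed

text \<open>With S the first-power step operator, T^(n+1) f - S^(n+1) f = (T - S) T^n f + S (T^n f -
  S^n f). The first summand is small by \<open>T_step_close\<close>, the second by induction and the
  uniform bound on S. The index \<open>Suc N\<close> keeps the mesh meaningful.\<close>

lemma T_step_power:
  assumes f: "f \<in> ell2 X"
  shows "(\<lambda>N. Re (ell2_inner X (\<lambda>x. (T ^^ n) f x - T_step (Suc N) n f x)
                (\<lambda>x. (T ^^ n) f x - T_step (Suc N) n f x))) \<longlonglongrightarrow> 0"
proof (induction n)
  case 0
  \<comment> \<open>The zeroth step operator \<open>?P\<close> is idempotent and self-adjoint, and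
    its form at \<open>f\<close> is the full mass of \<open>spec f\<close>; so |f|^2, |P f|^2 and
    <f, P f> agree and the error vanishes exactly.\<close>
  have "Re (ell2_inner X (\<lambda>x. f x - T_step (Suc N) 0 f x) (\<lambda>x. f x - T_step (Suc N) 0 f x)) = 0" for N
  proof -
    interpret finite_measure "spec f" by (rule finite_measure_spec[OF f])
    let ?P = "step_op (Suc N) (cells (Suc N)) (\<lambda>_. 1)"
    have P: "?P f \<in> ell2 X" by (intro linear_on_ell2D(1)[OF step_op_linear] f) simp
    have "ell2_inner X (?P f) f = complex_of_real (Re (ell2_inner X f f))"
      using step_op_integral(2)[OF _ f cells_cover[OF f], of "Suc N" "\<lambda>_. 1"] measure_spec_UNIV[OF f]
      by simp
    moreover have "ell2_inner X (?P f) (?P f) = ell2_inner X (?P f) f"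
      using step_op_adjoint[OF _ P f, of "cells (Suc N)" "Suc N" "\<lambda>_. 1"]
        step_op_mult[OF _ f, of "cells (Suc N)" "Suc N" "\<lambda>_. 1" "\<lambda>_. 1"] by simp
    moreover have "ell2_inner X f (?P f) = ell2_inner X (?P f) f"
      using step_op_adjoint[OF _ f f, of "cells (Suc N)" "Suc N" "\<lambda>_. 1"] by simp
    ultimately show ?thesis
      using Re_ell2_inner_diff[OF f P] by (simp del: of_nat_Suc)
  qed
  then show ?case by (simp del: of_nat_Suc)
next
  case (Suc n)
  let ?q = "\<lambda>g. Re (ell2_inner X g g)"
  let ?d = "\<lambda>n N x. (T ^^ n) f x - T_step (Suc N) n f x"
  note Tn = linear_on_ell2_power[OF linear_T f]
  have Sn: "T_step N n f \<in> ell2 X" for N n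
    by (intro linear_on_ell2D(1)[OF step_op_linear] f) simp
  let ?b = "\<lambda>N. 2 * ((1 / real (Suc N))\<^sup>2 * ?q ((T ^^ n) f)) + 2 * ((bd + 1)\<^sup>2 * ?q (?d n N))"
  have le: "?q (?d (Suc n) N) \<le> ?b N" for N
  proof -
    let ?S = "T_step (Suc N) 1"
    have S: "linear_on_ell2 X ?S" by (intro step_op_linear) simp
    have d: "?d n N \<in> ell2 X" by (intro ell2_diff Tn Sn)
    have SS: "?S (T_step (Suc N) n f) = T_step (Suc N) (Suc n) f"
      by (subst step_op_mult) (simp_all add: f del: of_nat_Suc)
    have "?S (\<lambda>x. 1 * (T ^^ n) f x + (-1) * T_step (Suc N) n f x)
        = (\<lambda>x. 1 * ?S ((T ^^ n) f) x + (-1) * ?S (T_step (Suc N) n f) x)"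
      by (rule linear_on_ell2D(2)[OF S Tn Sn])
    then have Sd: "?S (?d n N) = (\<lambda>x. ?S ((T ^^ n) f) x - T_step (Suc N) (Suc n) f x)"
      unfolding SS by (simp only: mult_1 mult_minus1 add_uminus_conv_diff)
    \<comment> \<open>The telescoping identity that drives the induction.\<close>
    have e: "?d (Suc n) N = (\<lambda>x. (T ((T ^^ n) f) x - ?S ((T ^^ n) f) x) + ?S (?d n N) x)"
      unfolding Sd by (simp only: funpow.simps comp_apply) (simp only: diff_add_cancel add_diff_eq)
    have "?q (?d (Suc n) N) \<le> 2 * ?q (\<lambda>x. T ((T ^^ n) f) x - ?S ((T ^^ n) f) x) + 2 * ?q (?S (?d n N))"
      unfolding e
      by (rule ell2_norm_add_le[OF ell2_diff[OF linear_on_ell2D(1)[OF linear_T Tn] linear_on_ell2D(1)[OF S Tn]]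
        linear_on_ell2D(1)[OF S d]])
    then show ?thesis
      using T_step_close[OF zero_less_Suc[of N] Tn[of n]] T_step_bound[OF zero_less_Suc[of N] d] by linarith
  qed
  have "?b \<longlonglongrightarrow>
      2 * (0\<^sup>2 * ?q ((T ^^ n) f)) + 2 * ((bd + 1)\<^sup>2 * 0)"
    by (intro tendsto_intros Suc.IH LIMSEQ_Suc[OF lim_1_over_n])
  then have lim: "?b \<longlonglongrightarrow> 0"
    by (simp only: power_zero_numeral mult_zero_left mult_zero_right add_0)
  show ?case
  proof (rule tendsto_0_le_squeeze)
    show "?q (?d (Suc n) N) \<le> ?b N" for N by (rule le)
  qed (rule Re_ell2_inner_self_nonneg, rule lim)
qed

lemma spec_power_integrable:
  assumes "f \<in> ell2 X"
  shows "integrable (spec f) (\<lambda>t. t ^ n)"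
  by (rule integrable_spec_bounded[OF assms _ _ bd(2)[OF assms], of _ "bd ^ n"])
     (auto simp: power_abs intro!: power_mono)

text \<open>The integrals of (floor(N t) / N)^n have two limits: the moment, by dominated
  convergence, and the matrix element of the n-th power of \<open>T\<close>, by
  \<open>T_step_power\<close> and Cauchy-Schwarz.\<close>

theorem spec_moment:
  assumes f: "f \<in> ell2 X"
  shows "(\<integral>t. t ^ n \<partial>spec f) = Re (ell2_inner X ((T ^^ n) f) f)"
proof -
  interpret finite_measure "spec f" by (rule finite_measure_spec[OF f])
  let ?s = "\<lambda>N t. (real_of_int \<lfloor>real (Suc N) * t\<rfloor> / real (Suc N)) ^ n"
  let ?d = "\<lambda>N x. (T ^^ n) f x - T_step (Suc N) n f x"
  have "(\<lambda>N. \<integral>t. ?s N t \<partial>spec f) \<longlonglongrightarrow> (\<integral>t. t ^ n \<partial>spec f)"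
  proof (rule integral_dominated_convergence[where w = "\<lambda>_. (bd + 1) ^ n"])
    show "AE t in spec f. (\<lambda>N. ?s N t) \<longlonglongrightarrow> t ^ n"
    proof (rule AE_I2)
      fix t
      have "(\<lambda>N. real_of_int \<lfloor>real (Suc N) * t\<rfloor> / real (Suc N) - t) \<longlonglongrightarrow> 0"
        by (rule Lim_null_comparison[OF _ LIMSEQ_Suc[OF lim_1_over_n]])
           (use floor_approx in \<open>auto simp del: of_nat_Suc\<close>)
      then show "(\<lambda>N. ?s N t) \<longlonglongrightarrow> t ^ n"
        by (intro tendsto_power) (rule LIM_zero_cancel)
    qed
    show "AE t in spec f. norm (?s N t) \<le> (bd + 1) ^ n" for N
      using bd(2)[OF f]
    proof eventually_elim
      case (elim t)
      have "1 / real (Suc N) \<le> 1" by simp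
      then have "\<bar>real_of_int \<lfloor>real (Suc N) * t\<rfloor> / real (Suc N)\<bar> \<le> bd + 1"
        using floor_approx[of "Suc N" t] elim by linarith
      then show ?case by (simp only: real_norm_def power_abs) (rule power_mono, simp_all)
    qed
  qed (auto simp del: of_nat_Suc)
  moreover have "(\<lambda>N. \<integral>t. ?s N t \<partial>spec f) \<longlonglongrightarrow> Re (ell2_inner X ((T ^^ n) f) f)"
  proof -
    note Tn = linear_on_ell2_power[OF linear_T f]
    have Sn: "T_step N n f \<in> ell2 X" for N
      by (intro linear_on_ell2D(1)[OF step_op_linear] f) simp
    have "ell2_inner X (\<lambda>x. 1 * (T ^^ n) f x + (-1) * T_step (Suc N) n f x) f
        = 1 * ell2_inner X ((T ^^ n) f) f + (-1) * ell2_inner X (T_step (Suc N) n f) f" for N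
      by (rule ell2_inner_lincomb[OF Tn Sn f])
    moreover have "ell2_inner X (T_step (Suc N) n f) f = complex_of_real (\<integral>t. ?s N t \<partial>spec f)" for N
      by (rule step_op_integral(2)[OF finite_atLeastAtMost_int f cells_cover[OF f]])
    ultimately have eq: "(\<integral>t. ?s N t \<partial>spec f)
        = Re (ell2_inner X ((T ^^ n) f) f) - Re (ell2_inner X (?d N) f)" for N
      by (simp only: mult_1 mult_minus1 add_uminus_conv_diff minus_complex.sel Re_complex_of_real)
    have "(\<lambda>N. sqrt (Re (ell2_inner X (?d N) (?d N)) * Re (ell2_inner X f f)))
        \<longlonglongrightarrow> sqrt (0 * Re (ell2_inner X f f))"
      by (intro tendsto_intros T_step_power f)
    then have lim: "(\<lambda>N. sqrt (Re (ell2_inner X (?d N) (?d N)) * Re (ell2_inner X f f))) \<longlonglongrightarrow> 0"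
      by (simp only: mult_zero_left real_sqrt_zero)
    have "(\<lambda>N. Re (ell2_inner X (?d N) f)) \<longlonglongrightarrow> 0"
    proof (rule Lim_null_comparison[OF always_eventually lim], rule allI)
      fix N
      have "(Re (ell2_inner X (?d N) f))\<^sup>2 \<le> Re (ell2_inner X (?d N) (?d N)) * Re (ell2_inner X f f)"
        by (intro ell2_Cauchy_Schwarz ell2_diff Tn Sn f)
      then show "norm (Re (ell2_inner X (?d N) f)) \<le> sqrt (Re (ell2_inner X (?d N) (?d N)) * Re (ell2_inner X f f))"
        unfolding real_norm_def by (intro real_le_rsqrt) (simp only: power2_abs)
    qed
    then have "(\<lambda>N. Re (ell2_inner X ((T ^^ n) f) f) - Re (ell2_inner X (?d N) f))
        \<longlonglongrightarrow> Re (ell2_inner X ((T ^^ n) f) f) - 0"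
      by (intro tendsto_diff tendsto_const)
    then show ?thesis unfolding eq by (simp only: diff_zero)
  qed
  ultimately show ?thesis by (rule LIMSEQ_unique)
qed

end


subsection \<open>Mixtures of measures on \<open>[-1, 1]\<close>\<close>

text \<open>For c > 1, Markov's inequality for the even moment of order 2n bounds the mass of both
  tails beyond c by c^(-2n), which tends to 0. The values c = 1 + 1/(k+1) exhaust the complement of
  [-1, 1] countably.\<close>

lemma AE_abs_le_1_if_moments_bounded:
  fixes M :: "real measure"
  assumes M: "prob_space M" "sets M = sets borel"
    and int: "\<And>n. integrable M (\<lambda>t. t ^ n)" and bound: "\<And>n. \<bar>\<integral>t. t ^ n \<partial>M\<bar> \<le> 1"
  shows "AE t in M. \<bar>t\<bar> \<le> 1"
proof -
  interpret prob_space M by fact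
  have sp: "space M = UNIV" using sets_eq_imp_space_eq[OF M(2)] by simp
  have "AE t in M. \<bar>t\<bar> < 1 + 1 / real (Suc k)" for k
  proof -
    define c where "c = 1 + 1 / real (Suc k)"
    have c: "c > 1" by (simp add: c_def)
    have A: "{t. c \<le> \<bar>t\<bar>} \<in> sets M" unfolding M(2) by measurable
    have le: "measure M {t. c \<le> \<bar>t\<bar>} \<le> (1 / c\<^sup>2) ^ n" for n
    proof -
      have "measure M {t. c \<le> \<bar>t\<bar>} \<le> measure M {t \<in> space M. t ^ (2 * n) \<ge> c ^ (2 * n)}"
      proof (rule finite_measure_mono)
        show "{t \<in> space M. t ^ (2 * n) \<ge> c ^ (2 * n)} \<in> sets M"
          unfolding sp M(2) by measurable
        show "{t. c \<le> \<bar>t\<bar>} \<subseteq> {t \<in> space M. t ^ (2 * n) \<ge> c ^ (2 * n)}"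
        proof safe
          fix t assume "c \<le> \<bar>t\<bar>"
          then have "c ^ (2 * n) \<le> \<bar>t\<bar> ^ (2 * n)" using c by (intro power_mono) auto
          then show "c ^ (2 * n) \<le> t ^ (2 * n)" by (simp add: power_even_abs)
        qed (simp add: sp)
      qed
      also have "\<dots> \<le> (\<integral>t. t ^ (2 * n) \<partial>M) / c ^ (2 * n)"
        using c by (intro integral_Markov_inequality_measure[where A = "{}"] int) auto
      also have "\<dots> \<le> 1 / c ^ (2 * n)"
        using bound[of "2 * n"] c by (intro divide_right_mono) auto
      finally show ?thesis by (simp add: power_mult power_divide)
    qed
    have "(\<lambda>n. (1 / c\<^sup>2) ^ n) \<longlonglongrightarrow> 0"
      using c by (intro LIMSEQ_power_zero) (simp add: power_gt1_lemma one_less_power)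
    then have "measure M {t. c \<le> \<bar>t\<bar>} \<le> 0"
      by (rule LIMSEQ_le_const) (use le in auto)
    then have "emeasure M {t. c \<le> \<bar>t\<bar>} = 0"
      by (simp add: emeasure_eq_measure measure_le_0_iff)
    with A have "AE t in M. t \<notin> {t. c \<le> \<bar>t\<bar>}" by (intro AE_not_in) (auto simp: null_sets_def)
    then show ?thesis by eventually_elim (simp add: c_def)
  qed
  then have "AE t in M. \<forall>k. \<bar>t\<bar> < 1 + 1 / real (Suc k)" by (simp add: AE_all_countable)
  then show ?thesis
  proof eventually_elim
    case (elim t)
    have "(\<lambda>k. 1 + 1 / real (Suc k)) \<longlonglongrightarrow> 1 + 0"
      by (intro tendsto_intros LIMSEQ_Suc[OF lim_1_over_n])
    then show ?case using elim by (intro LIMSEQ_le_const[of _ "1::real" "\<bar>t\<bar>"]) (auto intro: less_imp_le)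
  qed
qed

text \<open>\<open>N\<close> is an arbitrary family of measures, not a measurable kernel;
  measurability in \<omega> is supplied for the moments alone.\<close>

locale moment_mixture = prob_space \<Omega> for \<Omega> :: "'w measure" +
  fixes M :: "real measure" and N :: "'w \<Rightarrow> real measure"
  assumes M: "prob_space M" "sets M = sets borel" "AE t in M. \<bar>t\<bar> \<le> 1"
    and N: "\<omega> \<in> space \<Omega> \<Longrightarrow> prob_space (N \<omega>)" "\<omega> \<in> space \<Omega> \<Longrightarrow> sets (N \<omega>) = sets borel"
      "\<omega> \<in> space \<Omega> \<Longrightarrow> AE t in N \<omega>. \<bar>t\<bar> \<le> 1"
    and moment_measurable: "(\<lambda>\<omega>. \<integral>t. t ^ n \<partial>N \<omega>) \<in> borel_measurable \<Omega>"
    and moment_eq: "(\<integral>t. t ^ n \<partial>M) = (\<integral>\<omega>. (\<integral>t. t ^ n \<partial>N \<omega>) \<partial>\<Omega>)"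
begin

text \<open>A bound on [-1, 1] is all that the measures see, and it admits polynomials.\<close>

definition test :: "real \<Rightarrow> (real \<Rightarrow> real) \<Rightarrow> bool"
  where "test C h \<longleftrightarrow> h \<in> borel_measurable borel \<and> (\<forall>t. \<bar>t\<bar> \<le> 1 \<longrightarrow> \<bar>h t\<bar> \<le> C)"

text \<open>Measurability in \<omega> is bundled with the identity so that both pass through the
  same approximations, from powers to indicators of Borel sets.\<close>

definition mixes :: "(real \<Rightarrow> real) \<Rightarrow> bool"
  where "mixes h \<longleftrightarrow> (\<exists>C. test C h) \<and> (\<lambda>\<omega>. \<integral>t. h t \<partial>N \<omega>) \<in> borel_measurable \<Omega> \<and>
    (\<integral>t. h t \<partial>M) = (\<integral>\<omega>. (\<integral>t. h t \<partial>N \<omega>) \<partial>\<Omega>)"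

lemma test_integrable:
  fixes P :: "real measure"
  assumes "test C h" "prob_space P" "sets P = sets borel" "AE t in P. \<bar>t\<bar> \<le> 1"
  shows "integrable P h" "\<bar>\<integral>t. h t \<partial>P\<bar> \<le> C"
proof -
  interpret P: prob_space P by fact
  have m: "h \<in> borel_measurable P" using assms(1,3) by (auto simp: test_def cong: measurable_cong_sets)
  have b: "AE t in P. norm (h t) \<le> C" using assms(4) by eventually_elim (use assms(1) in \<open>auto simp: test_def\<close>)
  show i: "integrable P h" by (rule P.integrable_const_bound[OF b m])
  have "\<bar>\<integral>t. h t \<partial>P\<bar> \<le> (\<integral>t. \<bar>h t\<bar> \<partial>P)" by (rule integral_abs_bound)
  also have "\<dots> \<le> (\<integral>t. C \<partial>P)"
    by (rule integral_mono_AE) (use i b in auto)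
  finally show "\<bar>\<integral>t. h t \<partial>P\<bar> \<le> C" by (simp add: P.prob_space)
qed

lemma mixes_integrable:
  assumes "mixes h" shows "integrable \<Omega> (\<lambda>\<omega>. \<integral>t. h t \<partial>N \<omega>)"
proof -
  obtain C where C: "test C h" using assms by (auto simp: mixes_def)
  show ?thesis
    using assms by (intro integrable_const_bound[of _ C] AE_I2)
      (auto simp: mixes_def intro!: test_integrable(2)[OF C] N)
qed

lemma mixes_power: "mixes (\<lambda>t. t ^ n)"
proof -
  have "test 1 (\<lambda>t. t ^ n)"
    by (auto simp: test_def power_abs power_le_one)
  then show ?thesis using moment_measurable moment_eq by (auto simp: mixes_def)
qed

lemma mixes_lincomb:
  assumes f: "mixes f" and g: "mixes g"
  shows "mixes (\<lambda>t. a * f t + b * g t)"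
proof -
  obtain C D where CD: "test C f" "test D g" using assms by (auto simp: mixes_def)
  have eq: "(\<integral>t. a * f t + b * g t \<partial>P) = a * (\<integral>t. f t \<partial>P) + b * (\<integral>t. g t \<partial>P)"
    if "prob_space P" "sets P = sets borel" "AE t in P. \<bar>t\<bar> \<le> 1" for P
    using test_integrable(1)[OF CD(1) that] test_integrable(1)[OF CD(2) that] by simp
  have "test (\<bar>a\<bar> * C + \<bar>b\<bar> * D) (\<lambda>t. a * f t + b * g t)"
    unfolding test_def
  proof (intro conjI allI impI)
    fix t :: real assume "\<bar>t\<bar> \<le> 1"
    then have "\<bar>a\<bar> * \<bar>f t\<bar> \<le> \<bar>a\<bar> * C" "\<bar>b\<bar> * \<bar>g t\<bar> \<le> \<bar>b\<bar> * D"
      using CD by (auto simp: test_def intro!: mult_left_mono)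
    then show "\<bar>a * f t + b * g t\<bar> \<le> \<bar>a\<bar> * C + \<bar>b\<bar> * D"
      using abs_triangle_ineq[of "a * f t" "b * g t"] by (simp add: abs_mult)
  qed (use CD in \<open>auto simp: test_def\<close>)
  moreover have "(\<lambda>\<omega>. \<integral>t. a * f t + b * g t \<partial>N \<omega>) \<in> borel_measurable \<Omega>"
    using f g by (subst measurable_cong[OF eq[OF N]]) (auto simp: mixes_def)
  moreover have "(\<integral>\<omega>. (\<integral>t. a * f t + b * g t \<partial>N \<omega>) \<partial>\<Omega>)
      = (\<integral>\<omega>. a * (\<integral>t. f t \<partial>N \<omega>) + b * (\<integral>t. g t \<partial>N \<omega>) \<partial>\<Omega>)"
    by (intro Bochner_Integration.integral_cong eq N) auto
  ultimately show ?thesis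
    using f g mixes_integrable[OF f] mixes_integrable[OF g] by (auto simp: mixes_def eq[OF M])
qed

lemma mixes_sum: "finite I \<Longrightarrow> (\<And>i. i \<in> I \<Longrightarrow> mixes (h i)) \<Longrightarrow> mixes (\<lambda>t. \<Sum>i\<in>I. a i * h i t)"
proof (induction I rule: finite_induct)
  case empty
  show ?case using mixes_lincomb[OF mixes_power mixes_power, of 0 0 0 0] by simp
next
  case (insert i I)
  then show ?case using mixes_lincomb[of "h i" "\<lambda>t. \<Sum>i\<in>I. a i * h i t" "a i" 1] by simp
qed

text \<open>Dominated convergence is used twice with the same constant \<open>C\<close>: inside each
  measure, and then over \<Omega>. Measurability survives as a pointwise limit of measurable
  functions.\<close>

lemma mixes_limit:
  assumes h: "\<And>k::nat. mixes (h k)" "\<And>k. test C (h k)"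
    and g: "g \<in> borel_measurable borel"
    and lim: "\<And>t. \<bar>t\<bar> \<le> 1 \<Longrightarrow> (\<lambda>k. h k t) \<longlonglongrightarrow> g t"
  shows "mixes g"
proof -
  have conv: "(\<lambda>k. \<integral>t. h k t \<partial>P) \<longlonglongrightarrow> (\<integral>t. g t \<partial>P)"
    if P: "prob_space P" "sets P = sets borel" "AE t in P. \<bar>t\<bar> \<le> 1" for P
  proof (rule integral_dominated_convergence[where w = "\<lambda>_. C"])
    interpret P: prob_space P by fact
    show "integrable P (\<lambda>_. C)" by simp
    show "g \<in> borel_measurable P" "h k \<in> borel_measurable P" for k
      using g h(2) P(2) by (auto simp: test_def cong: measurable_cong_sets)
    show "AE t in P. (\<lambda>k. h k t) \<longlonglongrightarrow> g t" using P(3) by eventually_elim (rule lim)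
    show "AE t in P. norm (h k t) \<le> C" for k
      using P(3) by eventually_elim (use h(2) in \<open>auto simp: test_def\<close>)
  qed
  have "test C g"
    unfolding test_def
  proof (intro conjI allI impI g)
    fix t :: real assume t: "\<bar>t\<bar> \<le> 1"
    show "\<bar>g t\<bar> \<le> C"
      by (rule LIMSEQ_le_const2[OF tendsto_rabs[OF lim[OF t]]]) (use h(2) t in \<open>auto simp: test_def\<close>)
  qed
  moreover have meas: "(\<lambda>\<omega>. \<integral>t. g t \<partial>N \<omega>) \<in> borel_measurable \<Omega>"
    by (rule borel_measurable_LIMSEQ_real[OF conv[OF N]]) (use h(1) in \<open>auto simp: mixes_def\<close>)
  moreover have "(\<integral>t. g t \<partial>M) = (\<integral>\<omega>. (\<integral>t. g t \<partial>N \<omega>) \<partial>\<Omega>)"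
  proof (rule LIMSEQ_unique[OF conv[OF M]])
    have "(\<lambda>k. \<integral>\<omega>. (\<integral>t. h k t \<partial>N \<omega>) \<partial>\<Omega>) \<longlonglongrightarrow> (\<integral>\<omega>. (\<integral>t. g t \<partial>N \<omega>) \<partial>\<Omega>)"
      by (rule integral_dominated_convergence[where w = "\<lambda>_. C"])
         (use h(1) in \<open>auto simp: mixes_def intro!: meas AE_I2 conv N test_integrable(2)[OF h(2)]\<close>)
    then show "(\<lambda>k. \<integral>t. h k t \<partial>M) \<longlonglongrightarrow> (\<integral>\<omega>. (\<integral>t. g t \<partial>N \<omega>) \<partial>\<Omega>)"
      using h(1) by (simp add: mixes_def)
  qed
  ultimately show ?thesis by (auto simp: mixes_def)
qed

text \<open>Uniform approximation by polynomials on the compact interval [-1, 1]; polynomials mix by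
  linearity.\<close>

lemma mixes_continuous:
  assumes f: "continuous_on UNIV f"
  shows "mixes f"
proof -
  have fc: "continuous_on {-1..1} f" using f continuous_on_subset by blast
  have "\<exists>p. real_polynomial_function p \<and> (\<forall>t\<in>{-1..1}. \<bar>f t - p t\<bar> < 1 / real (Suc k))" for k
    by (rule Stone_Weierstrass_real_polynomial_function[OF compact_Icc fc, of "1 / real (Suc k)"])
       (simp, blast)
  then obtain p where p: "\<And>k. real_polynomial_function (p k)"
    and pf: "\<And>k t. t \<in> {-1..1} \<Longrightarrow> \<bar>f t - p k t\<bar> < 1 / real (Suc k)" by metis
  obtain C where C: "\<And>t. t \<in> {-1..1} \<Longrightarrow> \<bar>f t\<bar> \<le> C"
    using compact_imp_bounded[OF compact_continuous_image[OF fc compact_Icc]]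
    unfolding bounded_iff by (metis imageI real_norm_def)
  have mp: "mixes (p k)" for k
  proof -
    obtain a n where "p k = (\<lambda>x. \<Sum>i\<le>n. a i * x ^ i)"
      using p[of k] unfolding real_polynomial_function_iff_sum by blast
    then show ?thesis using mixes_sum[of "{..n}" "\<lambda>i t. t ^ i" a] mixes_power by simp
  qed
  show ?thesis
  proof (rule mixes_limit[OF mp])
    \<comment> \<open>\<open>C\<close> bounds \<open>f\<close> on the interval and every approximant
      is within 1 of \<open>f\<close> there.\<close>
    show "test (C + 1) (p k)" for k
      unfolding test_def
    proof (intro conjI allI impI)
      show "p k \<in> borel_measurable borel" using mp[of k] by (auto simp: mixes_def test_def)
      fix t :: real assume "\<bar>t\<bar> \<le> 1"
      then have t: "t \<in> {-1..1}" by auto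
      have "1 / real (Suc k) \<le> 1" by simp
      then show "\<bar>p k t\<bar> \<le> C + 1" using pf[OF t, of k] C[OF t] by linarith
    qed
    show "f \<in> borel_measurable borel" using f by (rule borel_measurable_continuous_onI)
    fix t :: real assume "\<bar>t\<bar> \<le> 1"
    then have t: "t \<in> {-1..1}" by auto
    have "norm (p k t - f t) \<le> 1 / real (Suc k)" for k
      using pf[OF t, of k] by (simp only: real_norm_def abs_minus_commute[of "p k t"] less_imp_le)
    then have "(\<lambda>k. p k t - f t) \<longlonglongrightarrow> 0"
      by (intro Lim_null_comparison[OF always_eventually LIMSEQ_Suc[OF lim_1_over_n]] allI)
    then show "(\<lambda>k. p k t) \<longlonglongrightarrow> f t" by (rule LIM_zero_cancel)
  qed
qed

text \<open>For k > 0 the approximants are continuous ramps, equal to 1 up to \<open>a\<close> and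
  to 0 from a + 1/k on.\<close>

lemma mixes_atMost: "mixes (indicator {..a})"
proof (rule mixes_limit)
  let ?h = "\<lambda>k t. max 0 (min 1 (1 - real k * (t - a)))"
  show "mixes (?h k)" for k by (intro mixes_continuous continuous_intros)
  show "test 1 (?h k)" for k by (auto simp: test_def)
  fix t :: real
  show "(\<lambda>k. ?h k t) \<longlonglongrightarrow> indicator {..a} t"
  proof (cases "t \<le> a")
    case True
    then have "?h k t = 1" for k by (simp add: mult_nonneg_nonpos)
    with True show ?thesis by simp
  next
    case False
    then obtain n where n: "1 < real n * (t - a)" using reals_Archimedean3[of "t - a"] by auto
    have "?h k t = 0" if "k \<ge> n" for k
    proof -
      have "real n * (t - a) \<le> real k * (t - a)" using that False by (intro mult_right_mono) auto
      with n show ?thesis by simp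
    qed
    then have "(\<lambda>k. ?h k t) \<longlonglongrightarrow> 0"
      by (intro tendsto_eventually) (auto simp: eventually_sequentially)
    with False show ?thesis by simp
  qed
qed simp

text \<open>A Dynkin class argument: half-lines are closed under intersection and generate the Borel
  sets, while complements and disjoint countable unions are handled by linearity and bounded
  limits.\<close>

lemma mixes_indicator: "B \<in> sets borel \<Longrightarrow> mixes (indicator B)"
proof -
  have s: "sets (borel :: real measure) = sigma_sets UNIV (range atMost)"
    unfolding borel_eq_atMost by (rule sets_measure_of) simp
  have subset_Pow: "range (atMost :: real \<Rightarrow> _) \<subseteq> Pow UNIV" by simp
  have I: "Int_stable (range (atMost :: real \<Rightarrow> _))"
    by (auto simp: Int_stable_def)
  assume "B \<in> sets borel"
  then have "B \<in> sigma_sets UNIV (range atMost)" by (simp add: s)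
  with I subset_Pow show ?thesis
  proof (induction rule: sigma_sets_induct_disjoint)
    case (basic A) then show ?case using mixes_atMost by auto
  next
    case empty
    show ?case using mixes_lincomb[OF mixes_power mixes_power, of 0 0 0 0] by (simp add: indicator_def[abs_def])
  next
    case (compl A)
    have "indicator (UNIV - A) = (\<lambda>t. 1 * t ^ 0 + (-1) * indicator A t :: real)"
      by (auto split: split_indicator)
    then show ?case using mixes_lincomb[OF mixes_power[of 0] compl(2), of 1 "-1"] by (simp only:)
  next
    case (union A)
    show ?case
    proof (rule mixes_limit)
      let ?h = "\<lambda>k t. \<Sum>i<k. 1 * indicator (A i) t :: real"
      \<comment> \<open>Disjointness makes the partial sums indicators again, so they share the
        bound 1.\<close>
      have U: "?h k t = indicator (\<Union>i<k. A i) t" for k t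
        using disjoint_family_on_mono[OF subset_UNIV union(1), of "{..<k}"]
        by (simp add: indicator_UN_disjoint)
      show "mixes (?h k)" for k by (intro mixes_sum union) auto
      have bm: "A i \<in> sets borel" for i using union(2) by (auto simp: s)
      then show "test 1 (?h k)" for k unfolding U test_def by (auto simp: indicator_def)
      show "indicator (\<Union>i. A i) \<in> borel_measurable borel" using bm by auto
      show "(\<lambda>k. ?h k t) \<longlonglongrightarrow> indicator (\<Union>i. A i) t" for t
        unfolding U by (rule LIMSEQ_indicator_UN)
    qed
  qed
qed

theorem mixture:
  assumes B: "B \<in> sets borel"
  shows "integrable \<Omega> (\<lambda>\<omega>. measure (N \<omega>) B)"
    and "measure M B = (\<integral>\<omega>. measure (N \<omega>) B \<partial>\<Omega>)"
proof -
  note mi = mixes_indicator[OF B]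
  have eq: "(\<integral>t. indicator B t \<partial>P) = measure P B" if "sets P = sets borel" for P
    using B that sets_eq_imp_space_eq[OF that] by simp
  show "integrable \<Omega> (\<lambda>\<omega>. measure (N \<omega>) B)"
    using mixes_integrable[OF mi]
    by (rule Bochner_Integration.integrable_cong[THEN iffD1, rotated -1]) (simp_all only: eq N)
  have "(\<integral>\<omega>. measure (N \<omega>) B \<partial>\<Omega>) = (\<integral>\<omega>. (\<integral>t. indicator B t \<partial>N \<omega>) \<partial>\<Omega>)"
    by (intro Bochner_Integration.integral_cong refl) (simp only: eq N)
  then show "measure M B = (\<integral>\<omega>. measure (N \<omega>) B \<partial>\<Omega>)"
    using mi unfolding mixes_def eq[OF M(2)] by (simp only:)
qed

end


subsection \<open>Convolution operators and restricted kernels\<close>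

text \<open>By injectivity, summing the squares of f after \<sigma> over \<open>X\<close> is summing
  those of f over a subset of \<open>X\<close>; weights of modulus at most 1 do no harm.\<close>

lemma linear_on_ell2_shift:
  fixes X :: "'x set"
  assumes inj: "inj_on \<sigma> X" and map: "\<And>x. x \<in> X \<Longrightarrow> \<sigma> x \<in> X"
    and c: "\<And>x. cmod (c x) \<le> 1"
  shows "linear_on_ell2 X (\<lambda>f x. if x \<in> X then c x * f (\<sigma> x) else 0)"
  unfolding linear_on_ell2_def
proof (intro conjI ballI allI)
  fix f :: "'x \<Rightarrow> complex" assume f: "f \<in> ell2 X"
  have "(\<lambda>x. (cmod (f x))\<^sup>2) summable_on \<sigma> ` X"
    by (rule summable_on_subset_banach[of _ X]) (use f map in \<open>auto simp: ell2_def\<close>)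
  then have s: "(\<lambda>x. (cmod (f (\<sigma> x)))\<^sup>2) summable_on X"
    by (subst (asm) summable_on_reindex[OF inj]) (simp add: o_def)
  have "(\<lambda>x. (cmod (if x \<in> X then c x * f (\<sigma> x) else 0))\<^sup>2) summable_on X"
  proof (rule summable_on_le[OF s])
    fix x
    have "cmod (c x) * cmod (f (\<sigma> x)) \<le> 1 * cmod (f (\<sigma> x))"
      by (intro mult_right_mono c) simp
    then show "(cmod (if x \<in> X then c x * f (\<sigma> x) else 0))\<^sup>2 \<le> (cmod (f (\<sigma> x)))\<^sup>2"
      by (auto simp: norm_mult intro: power_mono)
  qed simp
  then show "(\<lambda>x. if x \<in> X then c x * f (\<sigma> x) else 0) \<in> ell2 X" by (auto simp: ell2_def)
qed (auto simp: algebra_simps)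

text \<open>A kernel of finite range is a finite sum of weighted translations.\<close>

lemma kernel_operator_linear:
  fixes k :: "'x \<Rightarrow> 'x \<Rightarrow> real"
  assumes S: "finite S" and inj: "\<And>s. s \<in> S \<Longrightarrow> inj_on (\<sigma> s) X"
    and map: "\<And>s x. s \<in> S \<Longrightarrow> x \<in> X \<Longrightarrow> \<sigma> s x \<in> X"
    and inj': "\<And>x. x \<in> X \<Longrightarrow> inj_on (\<lambda>s. \<sigma> s x) S"
    and range: "\<And>x y. x \<in> X \<Longrightarrow> y \<in> X \<Longrightarrow> k x y \<noteq> 0 \<Longrightarrow> \<exists>s\<in>S. y = \<sigma> s x"
    and k: "\<And>x y. \<bar>k x y\<bar> \<le> 1"
  shows "linear_on_ell2 X (kernel_operator X k)"
proof -
  have "kernel_operator X k f x = (\<Sum>s\<in>S. 1 * (if x \<in> X then of_real (k x (\<sigma> s x)) * f (\<sigma> s x) else 0))"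
    for f :: "'x \<Rightarrow> complex" and x
  proof (cases "x \<in> X")
    case True
    have "(\<Sum>\<^sub>\<infinity>y\<in>X. complex_of_real (k x y) * f y)
        = (\<Sum>\<^sub>\<infinity>y\<in>(\<lambda>s. \<sigma> s x) ` S. complex_of_real (k x y) * f y)"
      using True range map by (intro infsum_cong_neutral) auto
    \<comment> \<open>Distinct \<open>s\<close> reach distinct points from \<open>x\<close>, so no
      point is counted twice.\<close>
    also have "\<dots> = (\<Sum>s\<in>S. complex_of_real (k x (\<sigma> s x)) * f (\<sigma> s x))"
      using S by (simp add: sum.reindex[OF inj'[OF True]])
    finally show ?thesis using True by (simp add: kernel_operator_def)
  qed (simp add: kernel_operator_def)
  then have "kernel_operator X k
      = (\<lambda>f x. \<Sum>s\<in>S. 1 * (if x \<in> X then of_real (k x (\<sigma> s x)) * f (\<sigma> s x) else 0))"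
    by (intro ext)
  then show ?thesis
    using linear_on_ell2_sumI[OF S, of X "\<lambda>s f x. if x \<in> X then of_real (k x (\<sigma> s x)) * f (\<sigma> s x) else 0" "\<lambda>_. 1"]
      linear_on_ell2_shift[OF inj map, of _ "\<lambda>x. of_real (k x (\<sigma> _ x))"] k
    by (simp add: linear_on_ell2_shift[OF inj map])
qed

lemma (in group) restricted_operator_linear:
  assumes "finite (set_pmf \<mu>)" "set_pmf \<mu> \<subseteq> carrier G"
  shows "linear_on_ell2 (carrier G) (restricted_operator G \<mu> A)"
  unfolding restricted_operator_def
proof (rule kernel_operator_linear[where S = "set_pmf \<mu>" and \<sigma> = "\<lambda>s x. x \<otimes> s"])
  fix x y assume "x \<in> carrier G" "y \<in> carrier G" "restricted_kernel G \<mu> A x y \<noteq> 0"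
  moreover from this have "inv x \<otimes> y \<in> set_pmf \<mu>"
    by (auto simp: restricted_kernel_def set_pmf_iff split: if_splits)
  ultimately show "\<exists>s\<in>set_pmf \<mu>. y = x \<otimes> s"
    by (intro bexI[of _ "inv x \<otimes> y"]) (auto simp: m_assoc[symmetric])
next
  fix x assume "x \<in> carrier G"
  then show "inj_on (\<lambda>s. x \<otimes> s) (set_pmf \<mu>)"
    using assms by (intro inj_onI) (metis Units_l_cancel Units_eq subsetD)
qed (use assms in \<open>auto simp: inj_on_def restricted_kernel_def pmf_le_1\<close>)

lemma (in group) right_convolution_linear:
  assumes "finite (set_pmf \<mu>)" "set_pmf \<mu> \<subseteq> carrier G"
  shows "linear_on_ell2 (carrier G) (right_convolution G \<mu>)"
  unfolding right_convolution_def
proof (rule kernel_operator_linear[where S = "set_pmf \<mu>" and \<sigma> = "\<lambda>s x. x \<otimes> inv s"])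
  fix x y assume xy: "x \<in> carrier G" "y \<in> carrier G" "pmf \<mu> (inv y \<otimes> x) \<noteq> 0"
  then have "inv y \<otimes> x \<in> set_pmf \<mu>" by (auto simp: set_pmf_iff)
  moreover have "y = x \<otimes> inv (inv y \<otimes> x)"
    using xy by (simp add: inv_mult_group m_assoc[symmetric])
  ultimately show "\<exists>s\<in>set_pmf \<mu>. y = x \<otimes> inv s" by blast
next
  fix s assume "s \<in> set_pmf \<mu>"
  then show "inj_on (\<lambda>x. x \<otimes> inv s) (carrier G)" using assms by (auto simp: inj_on_def subset_iff)
next
  fix x assume "x \<in> carrier G"
  then show "inj_on (\<lambda>s. x \<otimes> inv s) (set_pmf \<mu>)"
    using assms by (intro inj_onI) (metis inv_closed inv_inv Units_l_cancel Units_eq subsetD)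
qed (use assms in \<open>auto simp: pmf_le_1\<close>)

lemma (in group) set_conv_power:
  "set_pmf \<mu> \<subseteq> carrier G \<Longrightarrow> set_pmf (conv_power G \<mu> n) \<subseteq> carrier G"
  by (induction n) (auto simp: convolve_def)

section \<open>Iterated operators applied to the point mass at the identity\<close>

lemma (in group) pmf_convolve:
  assumes "set_pmf p \<subseteq> carrier G" "set_pmf q \<subseteq> carrier G" and x: "x \<in> carrier G"
  shows "pmf (convolve G p q) x = (\<Sum>\<^sub>\<infinity>y\<in>carrier G. pmf p y * pmf q (inv y \<otimes> x))"
proof -
  have "pmf (convolve G p q) x = measure_pmf.prob (pair_pmf p q) ((\<lambda>(x, y). x \<otimes> y) -` {x})"
    by (simp add: convolve_def pmf_map)
  also have "\<dots> = measure_pmf.prob (pair_pmf p q) ((\<lambda>y. (y, inv y \<otimes> x)) ` carrier G)"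
  \<comment> \<open>The fibre of the multiplication may contain pairs outside the carrier, where no
    group law is available; such pairs have mass 0.\<close>
  proof (rule measure_prob_cong_0)
    fix z assume z: "z \<in> (\<lambda>(x, y). x \<otimes> y) -` {x} - (\<lambda>y. (y, inv y \<otimes> x)) ` carrier G"
    obtain a b where ab: "z = (a, b)" by (cases z)
    show "pmf (pair_pmf p q) z = 0"
    proof (rule ccontr)
      assume "pmf (pair_pmf p q) z \<noteq> 0"
      then have "z \<in> set_pmf (pair_pmf p q)" by (rule set_pmf_iff[THEN iffD2])
      then have "a \<in> carrier G" "b \<in> carrier G" using assms ab by auto
      moreover have "a \<otimes> b = x" using z ab by simp
      ultimately have "b = inv a \<otimes> x" by (metis inv_solve_left x)
      then show False using z ab \<open>a \<in> carrier G\<close> by auto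
    qed
  next
    fix z assume z: "z \<in> (\<lambda>y. (y, inv y \<otimes> x)) ` carrier G - (\<lambda>(x, y). x \<otimes> y) -` {x}"
    then show "pmf (pair_pmf p q) z = 0" using x by (auto simp: m_assoc[symmetric])
  qed
  also have "\<dots> = (\<Sum>\<^sub>\<infinity>z\<in>(\<lambda>y. (y, inv y \<otimes> x)) ` carrier G. pmf (pair_pmf p q) z)"
    by (simp add: measure_pmf_conv_infsetsum infsetsum_infsum pmf_abs_summable)
  also have "\<dots> = (\<Sum>\<^sub>\<infinity>y\<in>carrier G. pmf (pair_pmf p q) (y, inv y \<otimes> x))"
    by (subst infsum_reindex) (auto simp: inj_on_def o_def)
  finally show ?thesis by (simp add: pmf_pair)
qed

lemma (in group) right_convolution_power_delta:
  assumes "set_pmf \<mu> \<subseteq> carrier G" "x \<in> carrier G"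
  shows "(right_convolution G \<mu> ^^ n) (delta \<one>) x = of_real (pmf (conv_power G \<mu> n) x)"
  using assms(2)
proof (induction n arbitrary: x)
  case 0
  then show ?case by (auto simp: delta_def)
next
  case (Suc n)
  let ?g = "\<lambda>y. pmf (conv_power G \<mu> n) y * pmf \<mu> (inv y \<otimes> x)"
  have "(right_convolution G \<mu> ^^ Suc n) (delta \<one>) x
      = (\<Sum>\<^sub>\<infinity>y\<in>carrier G. complex_of_real (?g y))"
    unfolding funpow.simps comp_apply
    by (subst right_convolution_def, unfold kernel_operator_def)
       (simp add: Suc mult.commute cong: infsum_cong)
  also have "\<dots> = of_real (infsum ?g (carrier G))"
    by (rule infsum_of_real_complex)
  also have "infsum ?g (carrier G) = pmf (conv_power G \<mu> (Suc n)) x"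
    using pmf_convolve[OF set_conv_power[OF assms(1)] assms(1) Suc.prems] by simp
  finally show ?case .
qed

text \<open>This is where symmetry of \<open>\<mu>\<close> enters: the operator sums over the second
  argument of the kernel and so produces transition weights from x to the identity, whereas
  \<open>restricted_kernel_power\<close> is built from the identity to x.\<close>

lemma (in group) restricted_power_delta:
  assumes sym: "\<And>x. x \<in> carrier G \<Longrightarrow> pmf \<mu> (inv x) = pmf \<mu> x" and x: "x \<in> carrier G"
  shows "(restricted_operator G \<mu> A ^^ n) (delta \<one>) x = of_real (restricted_kernel_power G \<mu> A n \<one> x)"
  using x
proof (induction n arbitrary: x)
  case 0
  then show ?case by (auto simp: delta_def)
next
  case (Suc n)
  have k: "restricted_kernel G \<mu> A x y = restricted_kernel G \<mu> A y x" if "y \<in> carrier G" for y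
    using sym[of "inv x \<otimes> y"] that Suc.prems by (simp add: restricted_kernel_def inv_mult_group)
  have "(restricted_operator G \<mu> A ^^ Suc n) (delta \<one>) x
      = (\<Sum>\<^sub>\<infinity>y\<in>carrier G. complex_of_real (restricted_kernel_power G \<mu> A n \<one> y * restricted_kernel G \<mu> A y x))"
    unfolding funpow.simps comp_apply
    by (subst restricted_operator_def, unfold kernel_operator_def)
       (simp add: Suc k mult.commute cong: infsum_cong)
  then show ?case by (simp only: infsum_of_real_complex restricted_kernel_power.simps)
qed


subsection \<open>The lamplighter group and its random walk\<close>

locale lamplighter = G: group G + H: group H
  for G :: "('g, 'a) monoid_scheme" (structure) and H :: "('h, 'b) monoid_scheme" +
  assumes finite_H: "finite (carrier H)"
begin

lemma H_carrier_nonempty: "carrier H \<noteq> {}"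
  using H.one_closed by blast

lemma carrier_lamps:
  "carrier (lamps G H) =
    {\<eta> \<in> carrier G \<rightarrow>\<^sub>E carrier H. finite {x \<in> carrier G. \<eta> x \<noteq> \<one>\<^bsub>H\<^esub>}}"
  unfolding lamps_def by (simp add: carrier_sum_group H.is_group)

lemma one_lamps: "\<one>\<^bsub>lamps G H\<^esub> = (\<lambda>x\<in>carrier G. \<one>\<^bsub>H\<^esub>)"
  by (simp add: lamps_def)

lemma mult_lamps: "\<eta> \<otimes>\<^bsub>lamps G H\<^esub> \<zeta> = (\<lambda>x\<in>carrier G. \<eta> x \<otimes>\<^bsub>H\<^esub> \<zeta> x)"
  by (simp add: lamps_def)

lemma group_lamps: "group (lamps G H)"
  unfolding lamps_def by (simp add: H.is_group)

sublocale L: group "lamps G H" by (rule group_lamps)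

lemma translate_closed:
  assumes g: "g \<in> carrier G" and \<eta>: "\<eta> \<in> carrier (lamps G H)"
  shows "translate G g \<eta> \<in> carrier (lamps G H)"
proof -
  have "{x \<in> carrier G. \<eta> (inv g \<otimes> x) \<noteq> \<one>\<^bsub>H\<^esub>} \<subseteq> (\<lambda>x. g \<otimes> x) ` {x \<in> carrier G. \<eta> x \<noteq> \<one>\<^bsub>H\<^esub>}"
  proof
    fix x assume "x \<in> {x \<in> carrier G. \<eta> (inv g \<otimes> x) \<noteq> \<one>\<^bsub>H\<^esub>}"
    with g show "x \<in> (\<lambda>x. g \<otimes> x) ` {x \<in> carrier G. \<eta> x \<noteq> \<one>\<^bsub>H\<^esub>}"
      by (intro image_eqI[of _ _ "inv g \<otimes> x"]) (auto simp: G.m_assoc[symmetric])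
  qed
  then have "finite {x \<in> carrier G. \<eta> (inv g \<otimes> x) \<noteq> \<one>\<^bsub>H\<^esub>}"
    using \<eta> by (auto simp: carrier_lamps intro: finite_subset)
  then have "finite {x \<in> carrier G. translate G g \<eta> x \<noteq> \<one>\<^bsub>H\<^esub>}"
    by (rule rev_finite_subset) (auto simp: translate_def)
  then show ?thesis
    using g \<eta> by (auto simp: carrier_lamps translate_def PiE_def)
qed

lemma translate_mult:
  assumes "g \<in> carrier G"
  shows "translate G g (\<eta> \<otimes>\<^bsub>lamps G H\<^esub> \<zeta>) = translate G g \<eta> \<otimes>\<^bsub>lamps G H\<^esub> translate G g \<zeta>"
  using assms by (auto simp: translate_def mult_lamps)

lemma translate_translate:
  assumes "g \<in> carrier G" "k \<in> carrier G"
  shows "translate G g (translate G k \<eta>) = translate G (g \<otimes> k) \<eta>"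
  using assms by (auto simp: translate_def G.inv_mult_group G.m_assoc)

lemma translate_id: "\<eta> \<in> carrier (lamps G H) \<Longrightarrow> translate G \<one> \<eta> = \<eta>"
  by (auto simp: translate_def carrier_lamps PiE_def extensional_def)

lemma translate_one: "g \<in> carrier G \<Longrightarrow> translate G g \<one>\<^bsub>lamps G H\<^esub> = \<one>\<^bsub>lamps G H\<^esub>"
  by (auto simp: translate_def one_lamps)

lemma wreath_simps:
  "carrier (wreath H G) = carrier (lamps G H) \<times> carrier G"
  "(\<eta>, g) \<otimes>\<^bsub>wreath H G\<^esub> (\<zeta>, k) = (\<eta> \<otimes>\<^bsub>lamps G H\<^esub> translate G g \<zeta>, g \<otimes> k)"
  "\<one>\<^bsub>wreath H G\<^esub> = (\<one>\<^bsub>lamps G H\<^esub>, \<one>)"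
  by (auto simp: wreath_def)

lemma group_wreath: "group (wreath H G)"
proof (rule groupI)
  fix x y assume "x \<in> carrier (wreath H G)" "y \<in> carrier (wreath H G)"
  then show "x \<otimes>\<^bsub>wreath H G\<^esub> y \<in> carrier (wreath H G)"
    by (cases x; cases y) (auto simp: wreath_simps translate_closed)
next
  show "\<one>\<^bsub>wreath H G\<^esub> \<in> carrier (wreath H G)" by (simp add: wreath_simps)
next
  fix x y z
  assume "x \<in> carrier (wreath H G)" "y \<in> carrier (wreath H G)" "z \<in> carrier (wreath H G)"
  then show "x \<otimes>\<^bsub>wreath H G\<^esub> y \<otimes>\<^bsub>wreath H G\<^esub> z = x \<otimes>\<^bsub>wreath H G\<^esub> (y \<otimes>\<^bsub>wreath H G\<^esub> z)"
    by (cases x; cases y; cases z)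
       (auto simp: wreath_simps translate_mult translate_translate translate_closed L.m_assoc G.m_assoc)
next
  fix x assume "x \<in> carrier (wreath H G)"
  then show "\<one>\<^bsub>wreath H G\<^esub> \<otimes>\<^bsub>wreath H G\<^esub> x = x"
    by (cases x) (auto simp: wreath_simps translate_id)
next
  fix x assume x: "x \<in> carrier (wreath H G)"
  obtain \<eta> g where xe: "x = (\<eta>, g)" by (cases x)
  have c: "\<eta> \<in> carrier (lamps G H)" "g \<in> carrier G" using x by (auto simp: xe wreath_simps)
  \<comment> \<open>In the product ?y x the lamps of x are translated by \<open>inv g\<close> as
    well, so the two configurations cancel before the common translation.\<close>
  let ?y = "(translate G (inv g) (inv\<^bsub>lamps G H\<^esub> \<eta>), inv g)"
  have "?y \<otimes>\<^bsub>wreath H G\<^esub> x = \<one>\<^bsub>wreath H G\<^esub>"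
    using c by (simp add: xe wreath_simps translate_mult[symmetric] translate_one)
  moreover have "?y \<in> carrier (wreath H G)"
    using c by (simp add: wreath_simps translate_closed)
  ultimately show "\<exists>y\<in>carrier (wreath H G). y \<otimes>\<^bsub>wreath H G\<^esub> x = \<one>\<^bsub>wreath H G\<^esub>" by blast
qed

section \<open>Uniform lamp configurations and the randomization of one lamp\<close>

definition config :: "'g set \<Rightarrow> ('g \<Rightarrow> 'h) set"
  where "config R = {\<eta> \<in> carrier G \<rightarrow>\<^sub>E carrier H. \<forall>x\<in>carrier G - R. \<eta> x = \<one>\<^bsub>H\<^esub>}"

text \<open>The effect on the lamps of right multiplication in the wreath product by an embedded
  \<open>h\<close> while the walker stands at \<open>z\<close>.\<close>

definition toggle :: "'g \<Rightarrow> 'h \<Rightarrow> ('g \<Rightarrow> 'h) \<Rightarrow> 'g \<Rightarrow> 'h"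
  where "toggle z h \<eta> = (\<lambda>x\<in>carrier G. if x = z then \<eta> x \<otimes>\<^bsub>H\<^esub> h else \<eta> x)"

lemma config_subset_lamps: "finite R \<Longrightarrow> config R \<subseteq> carrier (lamps G H)"
proof
  fix \<eta> assume R: "finite R" and \<eta>: "\<eta> \<in> config R"
  have "{x \<in> carrier G. \<eta> x \<noteq> \<one>\<^bsub>H\<^esub>} \<subseteq> R" using \<eta> by (auto simp: config_def)
  then show "\<eta> \<in> carrier (lamps G H)"
    using \<eta> R by (auto simp: config_def carrier_lamps intro: finite_subset)
qed

lemma one_in_config: "\<one>\<^bsub>lamps G H\<^esub> \<in> config R"
  by (auto simp: config_def one_lamps)

lemma config_iff:
  "\<eta> \<in> config R \<longleftrightarrow> (\<forall>x. x \<notin> carrier G \<longrightarrow> \<eta> x = undefined) \<and>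
    (\<forall>x\<in>carrier G. \<eta> x \<in> carrier H) \<and> (\<forall>x\<in>carrier G. x \<notin> R \<longrightarrow> \<eta> x = \<one>\<^bsub>H\<^esub>)"
  by (auto simp: config_def PiE_iff extensional_def)

lemma config_bij:
  assumes "R \<subseteq> carrier G"
  shows "bij_betw (\<lambda>\<eta>. restrict \<eta> R) (config R) (R \<rightarrow>\<^sub>E carrier H)"
proof (rule bij_betw_byWitness[where f' = "\<lambda>f. \<lambda>x\<in>carrier G. if x \<in> R then f x else \<one>\<^bsub>H\<^esub>"])
  show "\<forall>f\<in>R \<rightarrow>\<^sub>E carrier H. restrict (\<lambda>x\<in>carrier G. if x \<in> R then f x else \<one>\<^bsub>H\<^esub>) R = f"
    using assms by (auto simp: fun_eq_iff PiE_iff extensional_def)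
qed (use assms in \<open>auto simp: config_iff fun_eq_iff\<close>)

lemma card_config: "R \<subseteq> carrier G \<Longrightarrow> finite R \<Longrightarrow> card (config R) = card (carrier H) ^ card R"
  using bij_betw_same_card[OF config_bij] by (simp add: card_PiE)

lemma finite_config: "R \<subseteq> carrier G \<Longrightarrow> finite R \<Longrightarrow> finite (config R)"
  using bij_betw_finite[OF config_bij] finite_H by (simp add: finite_PiE)

lemma config_nonempty: "config R \<noteq> {}"
  using one_in_config by blast

lemma config_empty: "config {} = {\<one>\<^bsub>lamps G H\<^esub>}"
  using one_in_config[of "{}"]
  by (auto simp: config_def one_lamps PiE_def extensional_def fun_eq_iff restrict_def)

abbreviation "fresh_lamp \<equiv> pmf_of_set (carrier H)"

lemma toggle_bij_inside:
  assumes "z \<in> R" "h \<in> carrier H"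
  shows "bij_betw (toggle z h) (config R) (config R)"
  by (rule bij_betw_byWitness[where f' = "toggle z (inv\<^bsub>H\<^esub> h)"])
     (use assms in \<open>auto simp: config_iff toggle_def fun_eq_iff H.m_assoc\<close>)

text \<open>On \<open>config R\<close> the lamp at \<open>z\<close> is still at the identity, so
  toggling writes \<open>h\<close> there; the inverse reads that value and resets the lamp.\<close>

lemma toggle_bij_outside:
  assumes "z \<in> carrier G" "z \<notin> R"
  shows "bij_betw (\<lambda>(\<eta>, h). toggle z h \<eta>) (config R \<times> carrier H) (config (insert z R))"
proof (rule bij_betw_byWitness[where f' = "\<lambda>\<eta>. (\<lambda>x\<in>carrier G. if x = z then \<one>\<^bsub>H\<^esub> else \<eta> x, \<eta> z)"])
qed (use assms in \<open>auto simp: config_iff toggle_def fun_eq_iff\<close>)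

text \<open>A lamp already randomized stays uniform under multiplication by any fixed
  \<open>h\<close>; a lamp still at the identity becomes the fresh uniform value. Repeated visits
  thus leave no trace, and only the set \<open>R\<close> matters.\<close>

lemma toggle_config:
  assumes R: "finite R" "R \<subseteq> carrier G" and z: "z \<in> carrier G"
  shows "bind_pmf (pmf_of_set (config R)) (\<lambda>\<eta>. map_pmf (\<lambda>h. toggle z h \<eta>) fresh_lamp)
    = pmf_of_set (config (insert z R))"
proof (cases "z \<in> R")
  case True
  have "bind_pmf (pmf_of_set (config R)) (\<lambda>\<eta>. map_pmf (\<lambda>h. toggle z h \<eta>) fresh_lamp)
      = bind_pmf fresh_lamp (\<lambda>h. map_pmf (toggle z h) (pmf_of_set (config R)))"
    unfolding map_pmf_def by (rule bind_commute_pmf)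
  also have "\<dots> = bind_pmf fresh_lamp (\<lambda>h. pmf_of_set (config R))"
    by (intro bind_pmf_cong refl map_pmf_of_set_bij_betw toggle_bij_inside True
          config_nonempty finite_config R)
       (simp add: finite_H H_carrier_nonempty)
  finally show ?thesis using True by (simp add: insert_absorb)
next
  case False
  have "bind_pmf (pmf_of_set (config R)) (\<lambda>\<eta>. map_pmf (\<lambda>h. toggle z h \<eta>) fresh_lamp)
      = map_pmf (\<lambda>(\<eta>, h). toggle z h \<eta>) (pair_pmf (pmf_of_set (config R)) fresh_lamp)"
    by (simp add: pair_pmf_def map_bind_pmf map_pmf_def bind_assoc_pmf bind_return_pmf)
  also have "pair_pmf (pmf_of_set (config R)) fresh_lamp = pmf_of_set (config R \<times> carrier H)"
    by (rule pmf_eqI)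
       (auto simp: pmf_pair pmf_of_set finite_config R config_nonempty finite_H H_carrier_nonempty
         card_cartesian_product indicator_def)
  also have "map_pmf (\<lambda>(\<eta>, h). toggle z h \<eta>) \<dots> = pmf_of_set (config (insert z R))"
    by (intro map_pmf_of_set_bij_betw toggle_bij_outside z False)
       (simp_all add: config_nonempty H_carrier_nonempty finite_config R finite_H)
  finally show ?thesis .
qed

end

locale lamplighter_walk = lamplighter G H
  for G :: "('g, 'a) monoid_scheme" (structure) and H :: "('h, 'b) monoid_scheme" +
  fixes \<mu> :: "'g pmf"
  assumes supp: "set_pmf \<mu> \<subseteq> carrier G" and finite_supp: "finite (set_pmf \<mu>)"
begin

text \<open>The joint law of the set of vertices whose lamp has been randomized during the first
  \<open>n\<close> steps and the position at time \<open>n\<close>.\<close>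

primrec visited :: "nat \<Rightarrow> ('g set \<times> 'g) pmf"
  where
    "visited 0 = return_pmf ({}, \<one>)"
  | "visited (Suc n) = bind_pmf (visited n)
      (\<lambda>(R, y). map_pmf (\<lambda>s. (insert (y \<otimes> s) (insert y R), y \<otimes> s)) \<mu>)"

lemma visited_support:
  "(R, y) \<in> set_pmf (visited n) \<Longrightarrow> finite R \<and> R \<subseteq> carrier G \<and> y \<in> carrier G"
proof (induction n arbitrary: R y)
  case (Suc n)
  then obtain R' y' s where q: "(R', y') \<in> set_pmf (visited n)" and s: "s \<in> set_pmf \<mu>"
    and R: "R = insert (y' \<otimes> s) (insert y' R')" "y = y' \<otimes> s" by auto
  then show ?case using Suc.IH[OF q] supp by auto
qed simp

lemma finite_visited: "finite (set_pmf (visited n))"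
  using finite_supp by (induction n) auto

lemma embed_lamp_closed: "h \<in> carrier H \<Longrightarrow> embed_lamp H G h \<in> carrier (wreath H G)"
  by (auto simp: embed_lamp_def wreath_simps carrier_lamps
      intro: finite_subset[of _ "{\<one>}"] split: if_splits)

lemma embed_base_closed: "s \<in> carrier G \<Longrightarrow> embed_base H G s \<in> carrier (wreath H G)"
  by (simp add: embed_base_def wreath_simps)

lemma lamplighter_law_alt:
  "lamplighter_law H G \<mu> = bind_pmf fresh_lamp (\<lambda>h. bind_pmf \<mu> (\<lambda>s. bind_pmf fresh_lamp (\<lambda>k.
     return_pmf (embed_lamp H G h \<otimes>\<^bsub>wreath H G\<^esub> embed_base H G s \<otimes>\<^bsub>wreath H G\<^esub> embed_lamp H G k))))"
  by (simp add: lamplighter_law_def convolve_def Let_def pair_pmf_def map_pmf_def bind_assoc_pmf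
      bind_return_pmf)

lemma set_lamplighter_law: "set_pmf (lamplighter_law H G \<mu>) \<subseteq> carrier (wreath H G)"
  using supp unfolding lamplighter_law_alt
  by (auto simp: finite_H H_carrier_nonempty
      intro!: monoid.m_closed[OF group.is_monoid[OF group_wreath]] embed_lamp_closed embed_base_closed)

lemma finite_lamplighter_law: "finite (set_pmf (lamplighter_law H G \<mu>))"
  unfolding lamplighter_law_alt using finite_supp finite_H H_carrier_nonempty by simp

text \<open>The first \<nu>-factor acts at the old position and the second at the new one. If
  \<open>s\<close> is the identity, the same lamp is simply toggled twice.\<close>

lemma lamplighter_step:
  assumes "\<eta> \<in> carrier (lamps G H)" "y \<in> carrier G" "h \<in> carrier H" "s \<in> carrier G" "k \<in> carrier H"
  shows "(\<eta>, y) \<otimes>\<^bsub>wreath H G\<^esub>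
      (embed_lamp H G h \<otimes>\<^bsub>wreath H G\<^esub> embed_base H G s \<otimes>\<^bsub>wreath H G\<^esub> embed_lamp H G k)
    = (toggle (y \<otimes> s) k (toggle y h \<eta>), y \<otimes> s)"
proof -
  have m: "\<eta> x \<in> carrier H" if "x \<in> carrier G" for x
    using assms(1) that by (auto simp: carrier_lamps)
  have i: "inv y \<otimes> x = \<one> \<longleftrightarrow> x = y" if "x \<in> carrier G" for x
    using assms(2) that by (metis G.inv_closed G.inv_equality G.inv_inv G.l_inv)
  have j: "inv s \<otimes> (inv y \<otimes> x) = \<one> \<longleftrightarrow> x = y \<otimes> s" if "x \<in> carrier G" for x
  proof -
    have "inv s \<otimes> (inv y \<otimes> x) = inv (y \<otimes> s) \<otimes> x"
      using assms that by (simp add: G.inv_mult_group G.m_assoc)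
    then show ?thesis
      using assms that by (metis G.inv_closed G.inv_equality G.inv_inv G.l_inv G.m_closed)
  qed
  show ?thesis
    unfolding embed_lamp_def embed_base_def wreath_simps translate_one[OF G.one_closed]
    using assms
    by (auto simp: wreath_simps mult_lamps one_lamps translate_def toggle_def i j m H.m_assoc fun_eq_iff restrict_def)
qed

theorem conv_power_lamplighter:
  "conv_power (wreath H G) (lamplighter_law H G \<mu>) n
    = bind_pmf (visited n) (\<lambda>(R, y). map_pmf (\<lambda>\<eta>. (\<eta>, y)) (pmf_of_set (config R)))"
proof (induction n)
  case 0
  show ?case
    by (simp add: bind_return_pmf config_empty pmf_of_set_singleton wreath_simps)
next
  case (Suc n)
  let ?m = "(\<otimes>\<^bsub>wreath H G\<^esub>)"
  have step: "bind_pmf (pmf_of_set (config R)) (\<lambda>\<eta>. bind_pmf (lamplighter_law H G \<mu>)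
        (\<lambda>w. return_pmf (?m (\<eta>, y) w)))
      = bind_pmf \<mu> (\<lambda>s. map_pmf (\<lambda>\<eta>. (\<eta>, y \<otimes> s)) (pmf_of_set (config (insert (y \<otimes> s) (insert y R)))))"
    if R: "finite R" "R \<subseteq> carrier G" and y: "y \<in> carrier G" for R y
  proof -
    have "bind_pmf (pmf_of_set (config R)) (\<lambda>\<eta>. bind_pmf (lamplighter_law H G \<mu>)
        (\<lambda>w. return_pmf (?m (\<eta>, y) w)))
      = bind_pmf (pmf_of_set (config R)) (\<lambda>\<eta>. bind_pmf fresh_lamp (\<lambda>h. bind_pmf \<mu> (\<lambda>s.
          bind_pmf fresh_lamp (\<lambda>k. return_pmf (toggle (y \<otimes> s) k (toggle y h \<eta>), y \<otimes> s)))))"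
      unfolding lamplighter_law_alt bind_assoc_pmf bind_return_pmf
      using config_subset_lamps[OF R(1)] supp
      by (intro bind_pmf_cong refl arg_cong[where f = return_pmf] lamplighter_step y)
         (auto simp: finite_H H_carrier_nonempty finite_config R config_nonempty)
    \<comment> \<open>The independent choice of \<open>s\<close> is drawn first, so that the toggle
      at \<open>y\<close> can be merged with the uniform configuration before the toggle at the new
      position is applied.\<close>
    also have "\<dots> = bind_pmf \<mu> (\<lambda>s. bind_pmf (bind_pmf (pmf_of_set (config R))
          (\<lambda>\<eta>. map_pmf (\<lambda>h. toggle y h \<eta>) fresh_lamp))
        (\<lambda>\<eta>. bind_pmf fresh_lamp (\<lambda>k. return_pmf (toggle (y \<otimes> s) k \<eta>, y \<otimes> s))))"
      unfolding map_pmf_def bind_assoc_pmf bind_return_pmf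
      by (subst bind_commute_pmf[of fresh_lamp \<mu>], subst bind_commute_pmf[of "pmf_of_set (config R)" \<mu>]) (rule refl)
    also have "\<dots> = bind_pmf \<mu> (\<lambda>s. map_pmf (\<lambda>\<eta>. (\<eta>, y \<otimes> s))
        (bind_pmf (pmf_of_set (config (insert y R))) (\<lambda>\<eta>. map_pmf (\<lambda>k. toggle (y \<otimes> s) k \<eta>) fresh_lamp)))"
      unfolding toggle_config[OF R y] by (simp only: map_pmf_def bind_assoc_pmf bind_return_pmf)
    also have "\<dots> = bind_pmf \<mu> (\<lambda>s. map_pmf (\<lambda>\<eta>. (\<eta>, y \<otimes> s))
        (pmf_of_set (config (insert (y \<otimes> s) (insert y R)))))"
      using supp R y by (intro bind_pmf_cong refl arg_cong[where f = "map_pmf _"] toggle_config) auto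
    finally show ?thesis .
  qed
  have "conv_power (wreath H G) (lamplighter_law H G \<mu>) (Suc n)
      = bind_pmf (visited n) (\<lambda>(R, y). bind_pmf (pmf_of_set (config R)) (\<lambda>\<eta>.
          bind_pmf (lamplighter_law H G \<mu>) (\<lambda>w. return_pmf (?m (\<eta>, y) w))))"
    by (simp add: Suc convolve_def pair_pmf_def map_pmf_def bind_assoc_pmf bind_return_pmf case_prod_unfold)
  also have "\<dots> = bind_pmf (visited n) (\<lambda>(R, y). bind_pmf \<mu> (\<lambda>s. map_pmf (\<lambda>\<eta>. (\<eta>, y \<otimes> s))
      (pmf_of_set (config (insert (y \<otimes> s) (insert y R))))))"
    by (intro bind_pmf_cong refl) (auto dest!: visited_support intro!: step split: prod.splits)
  also have "\<dots> = bind_pmf (visited (Suc n)) (\<lambda>(R, y). map_pmf (\<lambda>\<eta>. (\<eta>, y)) (pmf_of_set (config R)))"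
    by (simp add: map_pmf_def bind_assoc_pmf bind_return_pmf case_prod_unfold)
  finally show ?case .
qed

section \<open>Return probabilities as sums over the visited set\<close>

lemma return_probability_lamplighter:
  "pmf (conv_power (wreath H G) (lamplighter_law H G \<mu>) n) \<one>\<^bsub>wreath H G\<^esub>
    = (\<Sum>(R, y)\<in>set_pmf (visited n). pmf (visited n) (R, y) *
        (if y = \<one> then (1 / real (card (carrier H))) ^ card R else 0))"
proof -
  have "pmf (map_pmf (\<lambda>\<eta>. (\<eta>, y)) (pmf_of_set (config R))) (\<one>\<^bsub>lamps G H\<^esub>, \<one>)
      = (if y = \<one> then (1 / real (card (carrier H))) ^ card R else 0)"
    if "(R, y) \<in> set_pmf (visited n)" for R y
  proof (cases "y = \<one>")
    case True
    have "pmf (map_pmf (\<lambda>\<eta>. (\<eta>, y)) (pmf_of_set (config R))) (\<one>\<^bsub>lamps G H\<^esub>, y)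
        = pmf (pmf_of_set (config R)) \<one>\<^bsub>lamps G H\<^esub>"
      by (rule pmf_map_inj') (simp add: inj_on_def)
    then show ?thesis
      using True visited_support[OF that]
      by (simp add: pmf_of_set config_nonempty finite_config card_config one_in_config power_divide)
  next
    case False
    then show ?thesis by (auto simp: pmf_eq_0_set_pmf)
  qed
  then show ?thesis
    unfolding conv_power_lamplighter wreath_simps pmf_bind
    by (subst integral_measure_pmf[OF finite_visited])
       (auto simp: case_prod_unfold intro!: sum.cong)
qed

text \<open>The killed walk is the free walk on the event \<open>R \<subseteq> A\<close>: the kernel
  requires both endpoints of a step to be in \<open>A\<close>, and \<open>visited\<close> records
  both. For \<open>n = 0\<close> the recorded set is empty, so the value is 1 at the identity even
  if \<open>A\<close> is empty.\<close>

lemma restricted_kernel_power_visited: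
  assumes "y \<in> carrier G"
  shows "restricted_kernel_power G \<mu> A n \<one> y
    = measure_pmf.expectation (visited n) (\<lambda>(R, z). if R \<subseteq> A \<and> z = y then 1 else 0)"
  using assms
proof (induction n arbitrary: y)
  case 0
  then show ?case by auto
next
  case (Suc n)
  let ?V = "set_pmf (visited n)" and ?k = "\<lambda>z. restricted_kernel G \<mu> A z y"
  have IH: "restricted_kernel_power G \<mu> A n \<one> z
      = (\<Sum>q\<in>?V. pmf (visited n) q * (if fst q \<subseteq> A \<and> snd q = z then 1 else 0))" if "z \<in> carrier G" for z
    unfolding Suc.IH[OF that]
    by (subst integral_measure_pmf[OF finite_visited]) (simp_all add: case_prod_unfold)
  have "restricted_kernel_power G \<mu> A (Suc n) \<one> y
      = (\<Sum>\<^sub>\<infinity>z\<in>carrier G. restricted_kernel_power G \<mu> A n \<one> z * ?k z)" by simp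
  \<comment> \<open>Only the finitely many positions reached in \<open>n\<close> steps contribute,
    which removes all questions of convergence.\<close>
  also have "\<dots> = (\<Sum>\<^sub>\<infinity>z\<in>snd ` ?V. restricted_kernel_power G \<mu> A n \<one> z * ?k z)"
  proof (rule infsum_cong_neutral)
    fix z assume z: "z \<in> carrier G - snd ` ?V"
    then have "z \<in> carrier G" "\<And>q. q \<in> ?V \<Longrightarrow> snd q \<noteq> z" by auto
    then have "restricted_kernel_power G \<mu> A n \<one> z = 0"
      by (simp only: IH) (simp add: sum.neutral)
    then show "restricted_kernel_power G \<mu> A n \<one> z * ?k z = 0" by simp
  next
    fix z assume "z \<in> snd ` ?V - carrier G"
    then show "restricted_kernel_power G \<mu> A n \<one> z * ?k z = 0" using visited_support by auto
  qed simp
  also have "\<dots> = (\<Sum>z\<in>snd ` ?V. restricted_kernel_power G \<mu> A n \<one> z * ?k z)"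
    using finite_visited by simp
  also have "\<dots> = (\<Sum>z\<in>snd ` ?V. \<Sum>q\<in>?V. pmf (visited n) q * (if fst q \<subseteq> A \<and> snd q = z then 1 else 0) * ?k z)"
  proof (intro sum.cong refl)
    fix z assume "z \<in> snd ` ?V"
    then have "z \<in> carrier G" using visited_support by auto
    then show "restricted_kernel_power G \<mu> A n \<one> z * ?k z
        = (\<Sum>q\<in>?V. pmf (visited n) q * (if fst q \<subseteq> A \<and> snd q = z then 1 else 0) * ?k z)"
      by (simp only: IH sum_distrib_right)
  qed
  also have "\<dots> = (\<Sum>q\<in>?V. \<Sum>z\<in>snd ` ?V. if z = snd q then pmf (visited n) q * (if fst q \<subseteq> A then ?k z else 0) else 0)"
    by (subst sum.swap) (auto intro!: sum.cong)
  also have "\<dots> = (\<Sum>q\<in>?V. pmf (visited n) q * (if fst q \<subseteq> A then ?k (snd q) else 0))"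
    using finite_visited by (intro sum.cong refl) (subst sum.delta, auto)
  also have "\<dots> = (\<Sum>q\<in>?V. pmf (visited n) q *\<^sub>R measure_pmf.expectation
      (map_pmf (\<lambda>s. (insert (snd q \<otimes> s) (insert (snd q) (fst q)), snd q \<otimes> s)) \<mu>)
      (\<lambda>(R, z). if R \<subseteq> A \<and> z = y then 1 else 0))"
  proof (intro sum.cong refl)
    fix q assume q: "q \<in> ?V"
    obtain R z where qe: "q = (R, z)" by (cases q)
    have z: "z \<in> carrier G" using visited_support q qe by blast
    have eq: "z \<otimes> s = y \<longleftrightarrow> s = inv z \<otimes> y" if "s \<in> carrier G" for s
      using G.inv_solve_left[OF that z Suc.prems] by metis
    have "measure_pmf.expectation (map_pmf (\<lambda>s. (insert (z \<otimes> s) (insert z R), z \<otimes> s)) \<mu>)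
        (\<lambda>(R, z). if R \<subseteq> A \<and> z = y then 1 else 0)
      = (\<Sum>s\<in>set_pmf \<mu>. pmf \<mu> s * (if insert (z \<otimes> s) (insert z R) \<subseteq> A \<and> z \<otimes> s = y then 1 else 0))"
      unfolding integral_map_pmf by (subst integral_measure_pmf[OF finite_supp]) simp_all
    \<comment> \<open>A single increment leads from \<open>z\<close> to \<open>y\<close>; the
      requirement that \<open>z\<close> and \<open>y\<close> lie in \<open>A\<close> is absorbed
      into the kernel.\<close>
    also have "\<dots> = (\<Sum>s\<in>set_pmf \<mu>. if s = inv z \<otimes> y then (if R \<subseteq> A then ?k z else 0) else 0)"
    proof (intro sum.cong refl)
      fix s assume "s \<in> set_pmf \<mu>"
      then have s: "s \<in> carrier G" using supp by blast
      show "pmf \<mu> s * (if insert (z \<otimes> s) (insert z R) \<subseteq> A \<and> z \<otimes> s = y then 1 else 0)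
          = (if s = inv z \<otimes> y then (if R \<subseteq> A then ?k z else 0) else 0)"
      proof (cases "s = inv z \<otimes> y")
        case True
        then have "z \<otimes> s = y" using eq[OF s] by blast
        then show ?thesis unfolding restricted_kernel_def True[symmetric] by simp
      next
        case False
        then show ?thesis using eq[OF s] by simp
      qed
    qed
    also have "\<dots> = (if R \<subseteq> A then ?k z else 0)"
    proof (cases "inv z \<otimes> y \<in> set_pmf \<mu>")
      case True
      then show ?thesis using finite_supp by (simp add: sum.delta)
    next
      case False
      then have "pmf \<mu> (inv z \<otimes> y) = 0" by (metis pmf_eq_0_set_pmf)
      with False show ?thesis using finite_supp by (simp add: sum.delta restricted_kernel_def)
    qed
    finally show "pmf (visited n) q * (if fst q \<subseteq> A then ?k (snd q) else 0) = pmf (visited n) q *\<^sub>R measure_pmf.expectation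
      (map_pmf (\<lambda>s. (insert (snd q \<otimes> s) (insert (snd q) (fst q)), snd q \<otimes> s)) \<mu>)
      (\<lambda>(R, z). if R \<subseteq> A \<and> z = y then 1 else 0)" by (simp add: qe)
  qed
  also have "\<dots> = measure_pmf.expectation (visited (Suc n)) (\<lambda>(R, z). if R \<subseteq> A \<and> z = y then 1 else 0)"
    unfolding visited.simps
    by (subst pmf_expectation_bind[OF finite_visited _ subset_refl])
       (simp_all add: finite_supp case_prod_unfold)
  finally show ?case .
qed

lemma return_probability_restricted:
  "restricted_kernel_power G \<mu> A n \<one> \<one>
    = (\<Sum>(R, y)\<in>set_pmf (visited n). pmf (visited n) (R, y) * (if y = \<one> \<and> R \<subseteq> A then 1 else 0))"
  unfolding restricted_kernel_power_visited[OF G.one_closed]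
  by (subst integral_measure_pmf[OF finite_visited]) (auto simp: case_prod_unfold intro!: sum.cong)

text \<open>Consecutive positions are adjacent in the Cayley graph, so an open visited set is joined
  to the identity by an open path inside itself.\<close>

lemma visited_subset_cluster:
  assumes "(R, y) \<in> set_pmf (visited n)"
  shows "R \<subseteq> open_cluster G (set_pmf \<mu>) opn \<longleftrightarrow> (\<forall>x\<in>R. opn x)"
proof
  have "opn x" if "x \<in> open_cluster G (set_pmf \<mu>) opn" for x
  proof -
    have "opn \<one>" and "(\<lambda>u v. cayley_adj G (set_pmf \<mu>) u v \<and> opn u \<and> opn v)\<^sup>*\<^sup>* \<one> x"
      using that by (auto simp: open_cluster_def)
    from this(2,1) show "opn x" by (induction rule: rtranclp_induct) auto
  qed
  then show "\<forall>x\<in>R. opn x" if "R \<subseteq> open_cluster G (set_pmf \<mu>) opn" using that by blast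
  let ?C = "open_cluster G (set_pmf \<mu>) opn"
  \<comment> \<open>The induction also records where the walker stands. Before the first step
    \<open>R\<close> is empty and the identity may be closed; afterwards the current position always
    belongs to \<open>R\<close>.\<close>
  have "(R = {} \<and> y = \<one> \<or> y \<in> R) \<and> ((\<forall>x\<in>R. opn x) \<longrightarrow> R \<subseteq> ?C)"
    using assms
  proof (induction n arbitrary: R y)
    case (Suc n)
    then obtain R' y' s where q: "(R', y') \<in> set_pmf (visited n)" and s: "s \<in> set_pmf \<mu>"
      and R: "R = insert (y' \<otimes> s) (insert y' R')" "y = y' \<otimes> s" by auto
    have "R \<subseteq> ?C" if op: "\<forall>x\<in>R. opn x"
    proof -
      \<comment> \<open>At the first step \<open>y'\<close> is the identity, not yet in
        \<open>R'\<close>; it belongs to \<open>R\<close>, hence is open and lies in its own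
        cluster. Later \<open>y'\<close> is covered by the induction hypothesis.\<close>
      have y': "y' \<in> ?C"
        using Suc.IH[OF q] op by (auto simp: R open_cluster_def)
      moreover have "cayley_adj G (set_pmf \<mu>) y' y"
        using visited_support[OF q] supp s by (auto simp: cayley_adj_def R)
      ultimately have "y \<in> ?C"
        using op by (auto simp: open_cluster_def R intro: rtranclp.rtrancl_into_rtrancl)
      then show ?thesis using y' Suc.IH[OF q] op by (auto simp: R)
    qed
    then show ?case by (auto simp: R)
  qed auto
  then show "R \<subseteq> ?C" if "\<forall>x\<in>R. opn x" using that by blast
qed

end


subsection \<open>Averaging over percolation clusters\<close>

lemma spectral_measure_at_moments:
  assumes T: "linear_on_ell2 X T" and x: "x \<in> X" and M: "spectral_measure_at X T x M"
  shows "prob_space M" and "sets M = sets borel" and "integrable M (\<lambda>t. t ^ n)"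
    and "(\<integral>t. t ^ n \<partial>M) = Re ((T ^^ n) (delta x) x)"
proof -
  obtain E where E: "resolution_of_identity X T E" "M = diagonal_measure X E (delta x)"
    using M by (auto simp: spectral_measure_at_def)
  interpret spectral_resolution X T E by unfold_locales (fact E T)+
  note d = delta_ell2[OF x]
  have "measure M (space M) = 1"
    unfolding E(2) space_spec measure_spec_UNIV[OF d] ell2_inner_delta[OF x] by (simp add: delta_def)
  then show "prob_space M"
    using finite_measure_spec[OF d] by (intro prob_spaceI) (simp add: finite_measure.emeasure_eq_measure E(2))
  show "sets M = sets borel" by (simp add: E(2))
  show "integrable M (\<lambda>t. t ^ n)" using spec_power_integrable[OF d] by (simp add: E(2))
  show "(\<integral>t. t ^ n \<partial>M) = Re ((T ^^ n) (delta x) x)"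
    using spec_moment[OF d] by (simp add: E(2) ell2_inner_delta[OF x])
qed

locale lamplighter_percolation = lamplighter_walk G H \<mu> + prob_space \<Omega>
  for G :: "('g, 'a) monoid_scheme" (structure) and H :: "('h, 'b) monoid_scheme"
    and \<mu> :: "'g pmf" and \<Omega> :: "'w measure" +
  fixes opn :: "'g \<Rightarrow> 'w \<Rightarrow> bool"
  assumes symmetric: "x \<in> carrier G \<Longrightarrow> pmf \<mu> (inv x) = pmf \<mu> x"
    and percolation: "site_percolation \<Omega> (carrier G) opn (1 / real (card (carrier H)))"
begin

abbreviation "cluster \<omega> \<equiv> open_cluster G (set_pmf \<mu>) (\<lambda>x. opn x \<omega>)"

lemma all_open:
  assumes "finite R" "R \<subseteq> carrier G"
  shows "{\<omega> \<in> space \<Omega>. \<forall>x\<in>R. opn x \<omega>} \<in> sets \<Omega>"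
    and "prob {\<omega> \<in> space \<Omega>. \<forall>x\<in>R. opn x \<omega>} = (1 / real (card (carrier H))) ^ card R"
proof -
  let ?O = "\<lambda>x. {\<omega> \<in> space \<Omega>. opn x \<omega>}"
  have ind: "indep_events ?O (carrier G)"
    and p: "\<And>x. x \<in> carrier G \<Longrightarrow> prob (?O x) = 1 / real (card (carrier H))"
    using percolation by (auto simp: site_percolation_def)
  have ev: "?O x \<in> sets \<Omega>" if "x \<in> carrier G" for x
    using ind that by (auto simp: indep_events_def)
  have "{\<omega> \<in> space \<Omega>. \<forall>x\<in>R. opn x \<omega>} \<in> sets \<Omega> \<and>
      prob {\<omega> \<in> space \<Omega>. \<forall>x\<in>R. opn x \<omega>} = (1 / real (card (carrier H))) ^ card R"
  \<comment> \<open>The empty set does occur, for n = 0; independence speaks of nonempty index sets,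
    and an empty intersection is not the sample space.\<close>
  proof (cases "R = {}")
    case True
    then show ?thesis by (simp add: prob_space)
  next
    case False
    then have eq: "{\<omega> \<in> space \<Omega>. \<forall>x\<in>R. opn x \<omega>} = (\<Inter>x\<in>R. ?O x)" by auto
    have "(\<Inter>x\<in>R. ?O x) \<in> sets \<Omega>"
      using False assms ev by (intro sets.finite_INT) auto
    moreover have "prob (\<Inter>x\<in>R. ?O x) = (\<Prod>x\<in>R. prob (?O x))"
      using ind assms False by (auto simp: indep_events_def)
    ultimately show ?thesis
      unfolding eq using p assms by (simp add: subset_iff)
  qed
  then show "{\<omega> \<in> space \<Omega>. \<forall>x\<in>R. opn x \<omega>} \<in> sets \<Omega>"
    and "prob {\<omega> \<in> space \<Omega>. \<forall>x\<in>R. opn x \<omega>} = (1 / real (card (carrier H))) ^ card R" by auto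
qed

lemma return_probability_cluster:
  assumes "\<omega> \<in> space \<Omega>"
  shows "restricted_kernel_power G \<mu> (cluster \<omega>) n \<one> \<one>
    = (\<Sum>(R, y)\<in>set_pmf (visited n). pmf (visited n) (R, y) *
        (if y = \<one> then indicator {\<omega> \<in> space \<Omega>. \<forall>x\<in>R. opn x \<omega>} \<omega> else 0))"
  unfolding return_probability_restricted
proof (intro sum.cong refl)
  fix q assume q: "q \<in> set_pmf (visited n)"
  obtain R y where qe: "q = (R, y)" by (cases q)
  show "(case q of (R, y) \<Rightarrow> pmf (visited n) (R, y) * (if y = \<one> \<and> R \<subseteq> cluster \<omega> then 1 else 0))
    = (case q of (R, y) \<Rightarrow> pmf (visited n) (R, y) *
        (if y = \<one> then indicator {\<omega> \<in> space \<Omega>. \<forall>x\<in>R. opn x \<omega>} \<omega> else 0))"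
    using visited_subset_cluster[of R y n] q assms by (simp add: qe indicator_def)
qed

text \<open>The cluster enters only through the events that all of \<open>R\<close> is open, for
  finitely many finite \<open>R\<close>. This gives measurability in \<omega> without studying the
  cluster as a random set, and the expectation can be taken term by term.\<close>

lemma return_probability:
  shows "integrable \<Omega> (\<lambda>\<omega>. restricted_kernel_power G \<mu> (cluster \<omega>) n \<one> \<one>)" (is ?int)
    and "pmf (conv_power (wreath H G) (lamplighter_law H G \<mu>) n) \<one>\<^bsub>wreath H G\<^esub>
      = (\<integral>\<omega>. restricted_kernel_power G \<mu> (cluster \<omega>) n \<one> \<one> \<partial>\<Omega>)" (is ?eq)
proof -
  let ?f = "\<lambda>q \<omega>. pmf (visited n) q *
    (if snd q = \<one> then indicator {\<omega> \<in> space \<Omega>. \<forall>x\<in>fst q. opn x \<omega>} \<omega> else 0 :: real)"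
  have ev: "{\<omega> \<in> space \<Omega>. \<forall>x\<in>fst q. opn x \<omega>} \<in> sets \<Omega>"
    "prob {\<omega> \<in> space \<Omega>. \<forall>x\<in>fst q. opn x \<omega>} = (1 / real (card (carrier H))) ^ card (fst q)"
    if "q \<in> set_pmf (visited n)" for q
    using all_open[of "fst q"] visited_support[of "fst q" "snd q" n] that by auto
  have int: "integrable \<Omega> (?f q)" if "q \<in> set_pmf (visited n)" for q
    using ev(1)[OF that] by (cases "snd q = \<one>") (auto simp: emeasure_eq_measure)
  have eq: "restricted_kernel_power G \<mu> (cluster \<omega>) n \<one> \<one> = (\<Sum>q\<in>set_pmf (visited n). ?f q \<omega>)"
    if "\<omega> \<in> space \<Omega>" for \<omega>
    unfolding return_probability_cluster[OF that] by (simp only: case_prod_unfold prod.collapse)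
  have ints: "integrable \<Omega> (\<lambda>\<omega>. \<Sum>q\<in>set_pmf (visited n). ?f q \<omega>)"
    by (intro Bochner_Integration.integrable_sum int)
  show ?int
    by (rule Bochner_Integration.integrable_cong[THEN iffD1, OF refl _ ints]) (rule eq[symmetric])
  have "(\<integral>\<omega>. restricted_kernel_power G \<mu> (cluster \<omega>) n \<one> \<one> \<partial>\<Omega>)
      = (\<integral>\<omega>. (\<Sum>q\<in>set_pmf (visited n). ?f q \<omega>) \<partial>\<Omega>)"
    by (intro Bochner_Integration.integral_cong refl eq)
  also have "\<dots> = (\<Sum>q\<in>set_pmf (visited n). \<integral>\<omega>. ?f q \<omega> \<partial>\<Omega>)"
    by (intro Bochner_Integration.integral_sum int)
  also have "\<dots> = (\<Sum>q\<in>set_pmf (visited n). pmf (visited n) q *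
      (if snd q = \<one> then (1 / real (card (carrier H))) ^ card (fst q) else 0))"
  proof (intro sum.cong refl)
    fix q assume q: "q \<in> set_pmf (visited n)"
    show "(\<integral>\<omega>. ?f q \<omega> \<partial>\<Omega>) = pmf (visited n) q *
        (if snd q = \<one> then (1 / real (card (carrier H))) ^ card (fst q) else 0)"
      unfolding ev(2)[OF q, symmetric] using ev(1)[OF q] by (cases "snd q = \<one>") (simp_all add: Int_absorb1 sets.sets_into_space)
  qed
  finally show ?eq
    unfolding return_probability_lamplighter by (simp only: case_prod_unfold prod.collapse)
qed

text \<open>These bounds on the moments confine the spectral measure of every cluster to
  [-1, 1].\<close>

lemma return_probability_restricted_bounds:
  "0 \<le> restricted_kernel_power G \<mu> A n \<one> \<one>" "restricted_kernel_power G \<mu> A n \<one> \<one> \<le> 1"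
proof -
  have "(\<Sum>(R, y)\<in>set_pmf (visited n). pmf (visited n) (R, y) * (if y = \<one> \<and> R \<subseteq> A then 1 else 0))
      \<le> (\<Sum>q\<in>set_pmf (visited n). pmf (visited n) q)"
    by (intro sum_mono) auto
  also have "\<dots> = 1" by (intro sum_pmf_eq_1 finite_visited subset_refl)
  finally show "restricted_kernel_power G \<mu> A n \<one> \<one> \<le> 1"
    by (simp only: return_probability_restricted)
  show "0 \<le> restricted_kernel_power G \<mu> A n \<one> \<one>"
    unfolding return_probability_restricted by (intro sum_nonneg) auto
qed

text \<open>The moments of \<open>M\<close> are return probabilities of the lamplighter walk and
  those of \<open>N \<omega>\<close> are return weights on the cluster.
  \<open>return_probability\<close> is therefore the moment hypothesis of
  \<open>moment_mixture\<close>, and it also supplies the measurability.\<close>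

theorem plancherel_measure_mixture:
  assumes m: "is_plancherel_measure (wreath H G) (lamplighter_law H G \<mu>) M"
    and N: "\<And>\<omega>. \<omega> \<in> space \<Omega> \<Longrightarrow>
      spectral_measure_at (carrier G) (restricted_operator G \<mu> (cluster \<omega>)) \<one> (N \<omega>)"
    and B: "B \<in> sets borel"
  shows "integrable \<Omega> (\<lambda>\<omega>. measure (N \<omega>) B)" and "measure M B = (\<integral>\<omega>. measure (N \<omega>) B \<partial>\<Omega>)"
proof -
  interpret W: group "wreath H G" by (rule group_wreath)
  note Mm = spectral_measure_at_moments[OF W.right_convolution_linear[OF finite_lamplighter_law set_lamplighter_law]
      W.one_closed m[unfolded is_plancherel_measure_def]]
  have Mmom: "(\<integral>t. t ^ n \<partial>M) = pmf (conv_power (wreath H G) (lamplighter_law H G \<mu>) n) \<one>\<^bsub>wreath H G\<^esub>" for n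
    using Mm(4) by (simp add: W.right_convolution_power_delta[OF set_lamplighter_law])
  note Nm = spectral_measure_at_moments[OF G.restricted_operator_linear[OF finite_supp supp] G.one_closed N]
  have Nmom: "(\<integral>t. t ^ n \<partial>N \<omega>) = restricted_kernel_power G \<mu> (cluster \<omega>) n \<one> \<one>" if "\<omega> \<in> space \<Omega>" for \<omega> n
    using Nm(4)[OF that] by (simp add: G.restricted_power_delta[OF symmetric])
  interpret moment_mixture \<Omega> M N
  proof (intro moment_mixture.intro moment_mixture_axioms.intro prob_space_axioms)
    show "prob_space M" "sets M = sets borel" by (rule Mm)+
    show "AE t in M. \<bar>t\<bar> \<le> 1"
      by (rule AE_abs_le_1_if_moments_bounded[OF Mm(1-3)]) (simp add: Mmom pmf_le_1)
    fix \<omega> assume \<omega>: "\<omega> \<in> space \<Omega>"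
    show "prob_space (N \<omega>)" "sets (N \<omega>) = sets borel" by (rule Nm[OF \<omega>])+
    show "AE t in N \<omega>. \<bar>t\<bar> \<le> 1"
      by (rule AE_abs_le_1_if_moments_bounded[OF Nm(1-3)[OF \<omega>]])
         (simp add: Nmom[OF \<omega>] return_probability_restricted_bounds)
  next
    fix n
    show "(\<lambda>\<omega>. \<integral>t. t ^ n \<partial>N \<omega>) \<in> borel_measurable \<Omega>"
      using borel_measurable_integrable[OF return_probability(1)] by (subst measurable_cong[OF Nmom])
    have "(\<integral>\<omega>. (\<integral>t. t ^ n \<partial>N \<omega>) \<partial>\<Omega>) = (\<integral>\<omega>. restricted_kernel_power G \<mu> (cluster \<omega>) n \<one> \<one> \<partial>\<Omega>)"
      by (intro Bochner_Integration.integral_cong refl Nmom)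
    then show "(\<integral>t. t ^ n \<partial>M) = (\<integral>\<omega>. (\<integral>t. t ^ n \<partial>N \<omega>) \<partial>\<Omega>)"
      by (simp only: Mmom return_probability(2))
  qed
  show "integrable \<Omega> (\<lambda>\<omega>. measure (N \<omega>) B)" "measure M B = (\<integral>\<omega>. measure (N \<omega>) B \<partial>\<Omega>)"
    by (rule mixture[OF B])+
qed

end

theorem mainTheorem1:
  fixes G :: "('g, 'a) monoid_scheme" and H :: "('h, 'b) monoid_scheme"
    and \<mu> :: "'g pmf" and \<Omega> :: "'w measure" and opn :: "'g \<Rightarrow> 'w \<Rightarrow> bool"
  defines "C \<equiv> (\<lambda>\<omega>. open_cluster G (set_pmf \<mu>) (\<lambda>x. opn x \<omega>))"
  assumes "group G" and "group H"
    and "finite (carrier H)" and "card (carrier H) \<ge> 2"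
    and "set_pmf \<mu> \<subseteq> carrier G" and "finite (set_pmf \<mu>)"
    and "generate G (set_pmf \<mu>) = carrier G"
    and "\<And>x. x \<in> carrier G \<Longrightarrow> pmf \<mu> (inv\<^bsub>G\<^esub> x) = pmf \<mu> x"
    and "site_percolation \<Omega> (carrier G) opn (1 / real (card (carrier H)))"
  shows "(\<forall>\<mm> \<nn>. is_plancherel_measure (wreath H G) (lamplighter_law H G \<mu>) \<mm> \<longrightarrow>
            (\<forall>\<omega>\<in>space \<Omega>.
               spectral_measure_at (carrier G) (restricted_operator G \<mu> (C \<omega>)) \<one>\<^bsub>G\<^esub> (\<nn> \<omega>)) \<longrightarrow>
            (\<forall>B\<in>sets borel.
               integrable \<Omega> (\<lambda>\<omega>. measure (\<nn> \<omega>) B) \<and>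
               measure \<mm> B = (\<integral>\<omega>. measure (\<nn> \<omega>) B \<partial>\<Omega>))) \<and>
         (\<forall>n. integrable \<Omega> (\<lambda>\<omega>. restricted_kernel_power G \<mu> (C \<omega>) n \<one>\<^bsub>G\<^esub> \<one>\<^bsub>G\<^esub>) \<and>
            pmf (conv_power (wreath H G) (lamplighter_law H G \<mu>) n) \<one>\<^bsub>wreath H G\<^esub>
              = (\<integral>\<omega>. restricted_kernel_power G \<mu> (C \<omega>) n \<one>\<^bsub>G\<^esub> \<one>\<^bsub>G\<^esub> \<partial>\<Omega>))"
proof -
  interpret G: group G by fact
  interpret H: group H by fact
  interpret prob_space \<Omega> using assms(10) by (simp add: site_percolation_def)
  interpret lamplighter_percolation G H \<mu> \<Omega> opn
    by unfold_locales (use assms in auto)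
  show ?thesis
    unfolding C_def using plancherel_measure_mixture return_probability by blast
qed

end
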